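(* Let $\lambda=\mu^+$ for $\mu$ a singular cardinal, and let $(\bar C,\bar I)$ be an $S$-good pair for some stationary $S\subseteq\{\delta<\lambda:\mathrm{cf}(\delta)=\mathrm{cf}(\mu)\}$. If $\mathrm{id}_p(\bar C,\bar I)$ is not weakly $\mu$-saturated, then $\mathrm{Pr}_1(\mu^+,\mu^+,\mu^+,\mathrm{cf}(\mu))$ holds.
   Context: For a closed set $C$, $\mathrm{nacc}(C)=\{\alpha\in C:\sup(C\cap\alpha)<\alpha\}$ and $\mathrm{acc}(C)=C\setminus\mathrm{nacc}(C)$. An $S$-good pair is $(\bar C,\bar I)$ where: $\bar C=\langle C_\delta:\delta\in S\rangle$ with each $C_\delta$ closed unbounded in $\delta$; $\sup\{|C_\delta|:\delta\in S\}<\mu$; $\bar I=\langle I_\delta:\delta\in S\rangle$ where $I_\delta$ is the ideal on $C_\delta$ generated by the sets $\{\gamma\in C_\delta:\gamma\in\mathrm{acc}(C_\delta)\text{ or }\mathrm{cf}(\gamma)<\alpha\text{ or }\gamma<\beta\}$ for $\alpha<\mu,\beta<\delta$; and for every club $E\subseteq\lambda$, $\{\delta\in S:E\cap C_\delta\notin I_\delta\}$ is stationary. $\mathrm{id}_p(\bar C,\bar I)$ is the ideal of all $A\subseteq\lambda$ such that for some club $E\subseteq\lambda$, $E\cap A\cap C_\delta\in I_\delta$ for every $\delta\in S\cap E$. An ideal $I$ on a set $A$ is weakly $\sigma$-saturated if there is no function $\pi:A\to\sigma$ with $\pi^{-1}(i)\notin I$ for all $i<\sigma$. $\mathrm{Pr}_1(\lambda,\lambda,\sigma,\mathrm{cf}(\mu))$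 (for $\lambda=\mu^+$) means: there is $f:[\lambda]^2\to\sigma$ such that whenever $\langle t_\alpha:\alpha<\lambda\rangle$ is a sequence of pairwise disjoint elements of $[\lambda]^{<\mathrm{cf}(\mu)}$ and $\epsilon<\sigma$, there are $\alpha<\beta<\lambda$ with $f(\{\zeta,\xi\})=\epsilon$ for all $\zeta\in t_\alpha$, $\xi\in t_\beta$. *)

theory Defs
  imports Main
begin

unbundle cardinal_syntax

text \<open>The ordinals below \<open>\<lambda>\<close> are the elements of a type of class \<open>wellorder\<close>. An ordinal
  \<open>\<alpha> < \<lambda>\<close> is thus an element, and its set of predecessors is \<open>{..<\<alpha>}\<close>; \<open>\<lambda>\<close> itself has no
  element representing it, and as a set of predecessors it is \<open>UNIV\<close>. Notions that apply to
  ordinals up to and including \<open>\<lambda>\<close> therefore take a set of predecessors as argument.\<close>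

definition le_on :: "'a::wellorder set \<Rightarrow> 'a rel" where
  "le_on X = {(x, y). x \<in> X \<and> y \<in> X \<and> x \<le> y}"

text \<open>Least length of a cofinal sequence; \<open>cf 0 = 0\<close>, and the cofinality of a successor is 1.\<close>

definition cf :: "'a::wellorder \<Rightarrow> 'a" where
  "cf \<delta> = (LEAST \<theta>. \<exists>g. (\<forall>i<\<theta>. g i < \<delta>) \<and> (\<forall>x<\<delta>. \<exists>i<\<theta>. x \<le> g i))"

definition singular_cardinal :: "'a::wellorder \<Rightarrow> bool" where
  "singular_cardinal \<mu> \<longleftrightarrow>
     Card_order (le_on {..<\<mu>}) \<and> infinite {..<\<mu>} \<and> cf \<mu> < \<mu>"

text \<open>The whole type has order type \<open>\<mu>\<^sup>+\<close>.\<close>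

definition is_successor_of :: "'a::wellorder itself \<Rightarrow> 'a \<Rightarrow> bool" where
  "is_successor_of _ \<mu> \<longleftrightarrow> le_on (UNIV :: 'a set) =o cardSuc (le_on {..<\<mu>})"

text \<open>In the closure condition, the premises on \<open>\<alpha>\<close> force it to be a nonzero limit.\<close>

definition club_in :: "'a::wellorder set \<Rightarrow> 'a set \<Rightarrow> bool" where
  "club_in D C \<longleftrightarrow>
     C \<subseteq> D \<and>
     (\<forall>x\<in>D. \<exists>c\<in>C. x \<le> c) \<and>
     (\<forall>\<alpha>\<in>D. (\<exists>x. x < \<alpha>) \<and> (\<forall>x<\<alpha>. \<exists>c\<in>C. x < c \<and> c < \<alpha>) \<longrightarrow> \<alpha> \<in> C)"

definition stationary :: "'a::wellorder set \<Rightarrow> bool" where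
  "stationary S \<longleftrightarrow> (\<forall>E. club_in UNIV E \<longrightarrow> S \<inter> E \<noteq> {})"

text \<open>Least upper bound, used only for sets that are bounded; the empty set has supremum 0.\<close>

definition osup :: "'a::wellorder set \<Rightarrow> 'a" where
  "osup A = (LEAST u. \<forall>x\<in>A. x \<le> u)"

definition nacc_pts :: "'a::wellorder set \<Rightarrow> 'a set" where
  "nacc_pts C = {\<alpha> \<in> C. osup (C \<inter> {..<\<alpha>}) < \<alpha>}"

definition acc_pts :: "'a::wellorder set \<Rightarrow> 'a set" where
  "acc_pts C = C - nacc_pts C"

definition ideal_generated :: "'a set \<Rightarrow> 'a set set \<Rightarrow> 'a set set" where
  "ideal_generated X G = {B. B \<subseteq> X \<and> (\<exists>F. finite F \<and> F \<subseteq> G \<and> B \<subseteq> \<Union>F)}"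

text \<open>The condition on \<open>\<kappa>\<close> says \<open>sup {|C\<^sub>\<delta>| : \<delta> \<in> S} < \<mu>\<close>.\<close>

definition good_pair ::
  "'a::wellorder \<Rightarrow> 'a set \<Rightarrow> ('a \<Rightarrow> 'a set) \<Rightarrow> ('a \<Rightarrow> 'a set set) \<Rightarrow> bool" where
  "good_pair \<mu> S C I \<longleftrightarrow>
     (\<forall>\<delta>\<in>S. club_in {..<\<delta>} (C \<delta>)) \<and>
     (\<exists>\<kappa><\<mu>. \<forall>\<delta>\<in>S. |C \<delta>| \<le>o |{..<\<kappa>}| ) \<and>
     (\<forall>\<delta>\<in>S. I \<delta> = ideal_generated (C \<delta>)
        {{\<gamma> \<in> C \<delta>. \<gamma> \<in> acc_pts (C \<delta>) \<or> cf \<gamma> < \<alpha> \<or> \<gamma> < \<beta>} | \<alpha> \<beta>. \<alpha> < \<mu> \<and> \<beta> < \<delta>}) \<and>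
     (\<forall>E. club_in UNIV E \<longrightarrow> stationary {\<delta> \<in> S. E \<inter> C \<delta> \<notin> I \<delta>})"

definition id_p ::
  "'a::wellorder set \<Rightarrow> ('a \<Rightarrow> 'a set) \<Rightarrow> ('a \<Rightarrow> 'a set set) \<Rightarrow> 'a set set" where
  "id_p S C I = {A. \<exists>E. club_in UNIV E \<and> (\<forall>\<delta>\<in>S \<inter> E. E \<inter> A \<inter> C \<delta> \<in> I \<delta>)}"

text \<open>Here \<open>J\<close> is an ideal on \<open>A\<close>, and \<open>\<Sigma>\<close> is the set of predecessors of \<open>\<sigma>\<close>.\<close>

definition weakly_saturated :: "'a set \<Rightarrow> 'a set set \<Rightarrow> 'b set \<Rightarrow> bool" where
  "weakly_saturated A J \<Sigma> \<longleftrightarrow>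
     \<not> (\<exists>\<pi>. (\<forall>x\<in>A. \<pi> x \<in> \<Sigma>) \<and> (\<forall>i\<in>\<Sigma>. {x \<in> A. \<pi> x = i} \<notin> J))"

text \<open>\<open>Pr\<^sub>1(\<lambda>, \<kappa>, \<sigma>, \<theta>)\<close>, with each of the four ordinals given as a set of predecessors;
  \<open>\<kappa>\<close> is the length of the sequences \<open>t\<close>.\<close>

definition Pr1 ::
  "'a::wellorder set \<Rightarrow> 'a set \<Rightarrow> 'a set \<Rightarrow> 'a set \<Rightarrow> bool" where
  "Pr1 \<Lambda> K \<Sigma> \<Theta> \<longleftrightarrow>
     (\<exists>f :: 'a set \<Rightarrow> 'a.
        (\<forall>u. u \<subseteq> \<Lambda> \<and> card u = 2 \<longrightarrow> f u \<in> \<Sigma>) \<and>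
        (\<forall>t :: 'a \<Rightarrow> 'a set. \<forall>\<epsilon>\<in>\<Sigma>.
           (\<forall>\<alpha>\<in>K. t \<alpha> \<subseteq> \<Lambda> \<and> |t \<alpha>| <o |\<Theta>| ) \<and>
           (\<forall>\<alpha>\<in>K. \<forall>\<beta>\<in>K. \<alpha> \<noteq> \<beta> \<longrightarrow> t \<alpha> \<inter> t \<beta> = {}) \<longrightarrow>
           (\<exists>\<alpha>\<in>K. \<exists>\<beta>\<in>K. \<alpha> < \<beta> \<and> (\<forall>\<zeta>\<in>t \<alpha>. \<forall>\<xi>\<in>t \<beta>. f {\<zeta>, \<xi>} = \<epsilon>))))"

end

theory Submission
  imports Defs
begin

text \<open>Write \<open>\<theta> = cf \<mu>\<close>. Choose ladders \<open>e\<^sub>\<xi>\<close> of size \<open>< \<mu>\<close> such that \<open>C\<^sub>\<delta> \<subseteq> e\<^sub>\<xi>\<close> whenever \<open>e\<^sub>\<xi>\<close> is unbounded in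
  \<open>\<delta> \<in> S\<close>, and walk along them. If \<open>|t| < \<theta>\<close> and \<open>t\<close> lies above \<open>\<delta>\<close>, then for every \<open>\<gamma> \<in> C\<^sub>\<delta>\<close> that is close to \<open>\<delta>\<close> and
  has large cofinality, all walks from \<open>\<xi> \<in> t\<close> down to a point just below \<open>\<gamma>\<close> pass through \<open>\<gamma>\<close>, and \<open>\<gamma>\<close> is
  the first node whose ladder exceeds a certain size below \<open>\<mu>\<close>. So \<open>\<gamma>\<close> can be read off the walk once
  an index below \<open>\<theta>\<close> bounding that size is known. The index is supplied by a coloring with \<open>\<theta>\<close> colors, constructed
  in ZFC from a scale of length \<open>\<mu>\<^sup>+\<close> in a product of \<open>\<theta>\<close> ordinals whose cofinalities tend to \<open>\<mu>\<close>. Doing this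
  twice gives nodes \<open>\<gamma>\<^sub>1 > \<gamma>\<^sub>2\<close>: \<open>\<gamma>\<^sub>1 > \<epsilon>\<close> is arbitrary, and \<open>\<gamma>\<^sub>2\<close> is chosen with \<open>\<pi> \<gamma>\<^sub>2\<close> the index of \<open>\<epsilon>\<close> in a fixed
  enumeration of \<open>\<gamma>\<^sub>1\<close> by ordinals below \<open>\<mu>\<close>, where \<open>\<pi>\<close> witnesses the failure of weak saturation.\<close>

section \<open>Cardinality and cofinality\<close>

text \<open>The obstacle is the order of choices. The thresholds that make a walk stop at \<gamma>1
  and \<gamma>2, hence the two indices below \<theta>, are known only after the upper set
  \<open>t \<beta>\<close> is fixed, whereas the lower set must fit below \<gamma>2. So the small
  coloring has to realise every pair of indices against every \<open>t \<beta>\<close> beyond a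
  bound \<open>b0 a\<close> that depends on neither, and \<gamma>2 is taken from a club closed under
  \<open>b0\<close>. Likewise the index of \<epsilon> depends on \<gamma>1, while the point
  \<delta>2 whose \<open>C\<close> supplies \<gamma>2 must lie below \<gamma>1; so \<gamma>1 comes
  from a club closed under a simultaneous bound for all \<mu> possible choices of \<delta>2. Both
  nodes can be read from one pair because a walk with a larger threshold continues through
  \<gamma>1. The scale needs no cardinal arithmetic: it comes from an exact upper bound of a
  sequence of rank functions, one rank for each of \<theta> ways of cutting every ordinal into small
  pieces closed under limits. Club guessing on a triple successor below \<mu> controls these
  functions when they are rounded up into small sets.\<close>

lemma card_leI: "inj_on f A \<Longrightarrow> f ` A \<subseteq> B \<Longrightarrow> |A| \<le>o |B|"
  by (auto simp: card_of_ordLeq[symmetric])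

lemma card_le_trans: "|A| \<le>o |B| \<Longrightarrow> |B| \<le>o |C| \<Longrightarrow> |A| \<le>o |C|"
  by (rule ordLeq_transitive)

lemma card_le_subset: "A \<subseteq> A' \<Longrightarrow> |A'| \<le>o |B| \<Longrightarrow> |A| \<le>o |B|"
  using card_of_mono1 ordLeq_transitive by blast

lemma card_le_image: "|A| \<le>o |B| \<Longrightarrow> |f ` A| \<le>o |B|"
  using card_of_image ordLeq_transitive by blast

lemma card_le_refl: "|A| \<le>o |A|"
  by (simp add: card_of_mono1)

lemma card_le_Un:
  assumes "infinite C" "|A| \<le>o |C|" "|B| \<le>o |C|"
  shows "|A \<union> B| \<le>o |C|"
  by (rule card_of_Un_ordLeq_infinite_Field[where r = "|C|"])
    (use assms in \<open>auto simp: Field_card_of card_of_card_order_on\<close>)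

lemma card_le_Times:
  assumes "infinite C" "|A| \<le>o |C|" "|B| \<le>o |C|"
  shows "|A \<times> B| \<le>o |C|"
  by (rule card_of_Times_ordLeq_infinite_Field[where r = "|C|"])
    (use assms in \<open>auto simp: Field_card_of card_of_card_order_on\<close>)

lemma card_le_finite:
  assumes "infinite C" "finite A"
  shows "|A| \<le>o |C|"
  using assms card_of_ordLeq_finite card_of_Well_order ordLeq_total by metis

lemma card_le_insert:
  assumes "infinite C" "|A| \<le>o |C|"
  shows "|insert a A| \<le>o |C|"
  using card_le_Un[OF assms(1) card_le_finite[OF assms(1), of "{a}"] assms(2)] by simp

lemma card_le_UN:
  assumes "infinite C" "|I| \<le>o |C|" "\<And>i. i \<in> I \<Longrightarrow> |A i| \<le>o |C|"
  shows "|\<Union>i\<in>I. A i| \<le>o |C|"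
  using card_of_UNION_ordLeq_infinite[OF assms(1,2)] assms(3) by blast

section \<open>Initial segments of the type as cardinals, and cofinality as a bounding
  property\<close>

lemma Field_le_on [simp]: "Field (le_on X) = X"
  by (auto simp: le_on_def Field_def)

lemma Well_order_le_on: "Well_order (le_on X)"
proof -
  have "wf (le_on X - Id)"
    by (rule wf_subset[OF wf]) (auto simp: le_on_def)
  then show ?thesis
    by (auto simp: well_order_on_def linear_order_on_def partial_order_on_def preorder_on_def
        refl_on_def trans_def antisym_def total_on_def Field_def le_on_def)
qed

lemma Restr_le_on: "a \<in> X \<Longrightarrow> Restr (le_on X) (underS (le_on X) a) = le_on (X \<inter> {..<a})"
  by (auto simp: le_on_def underS_def)

lemma not_card_le_segment:
  fixes X :: "'a::wellorder set"
  assumes "Card_order (le_on X)" "a \<in> X"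
  shows "|X \<inter> {..<a}| <o |X|"
proof -
  have "le_on (X \<inter> {..<a}) <o le_on X"
    using underS_Restr_ordLess[OF Well_order_le_on, of X a] assms(2) by (auto simp: Restr_le_on)
  moreover have "|X \<inter> {..<a}| \<le>o le_on (X \<inter> {..<a})"
    using card_of_least[of "X \<inter> {..<a}" "le_on (X \<inter> {..<a})"] Well_order_le_on[of "X \<inter> {..<a}"] by simp
  moreover have "le_on X =o |X|"
    using card_of_Field_ordIso[OF assms(1)] ordIso_symmetric by auto
  ultimately show ?thesis
    by (meson ordLeq_ordLess_trans ordLess_ordIso_trans)
qed

text \<open>A smaller set, well-ordered by its cardinal, is isomorphic to a proper initial segment.
  The resulting index \<open>v\<close> is what \<open>bounding\<close> takes, so that bounds of the
  form \<open>|t \<alpha>| <o |{..<\<theta>}|\<close> become usable.\<close>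

lemma card_less_segment:
  fixes \<theta> :: "'a::wellorder"
  assumes "|B| <o |{..<\<theta>}|"
  obtains v where "v < \<theta>" "|B| \<le>o |{..<v}|"
proof -
  have "|B| <o le_on {..<\<theta>}"
    using assms card_of_least[of "{..<\<theta>}" "le_on {..<\<theta>}"] Well_order_le_on[of "{..<\<theta>}"]
    by (simp add: ordLess_ordLeq_trans)
  then obtain a where a: "a < \<theta>" "|B| =o Restr (le_on {..<\<theta>}) (underS (le_on {..<\<theta>}) a)"
    using ordLess_iff_ordIso_Restr[OF Well_order_le_on[of "{..<\<theta>}"] card_of_Well_order[of B]] by auto
  then have "|B| =o le_on {..<a}"
    using Restr_le_on[of a "{..<\<theta>}"] Int_absorb1[of "{..<a}" "{..<\<theta>}"] by simp
  then have "|B| \<le>o |{..<a}|"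
    using card_of_mono2[OF ordIso_imp_ordLeq, of "|B|" "le_on {..<a}"] by (simp add: Field_card_of)
  then show thesis using a that by blast
qed

text \<open>Stands for: the cofinality of \<open>D\<close> exceeds \<open>|v|\<close>. The form for
  sets also covers \<open>UNIV\<close> and the sets obtained by club guessing, to which
  \<open>cf\<close> does not apply. The case \<open>X = {}\<close> forces \<open>D\<close> to be
  nonempty.\<close>

definition bounding :: "'a::wellorder \<Rightarrow> 'a set \<Rightarrow> bool" where
  "bounding v D \<longleftrightarrow> (\<forall>X\<subseteq>D. |X| \<le>o |{..<v}| \<longrightarrow> (\<exists>c\<in>D. \<forall>x\<in>X. x < c))"

lemma boundingD:
  assumes "bounding v D" "|X| \<le>o |{..<v}|" "X \<subseteq> D"
  shows "\<exists>c\<in>D. \<forall>x\<in>X. x < c"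
  using assms unfolding bounding_def by simp

lemma bounding_image:
  assumes "bounding v D" "|K| \<le>o |{..<v}|" "F ` K \<subseteq> D"
  shows "\<exists>c\<in>D. \<forall>k\<in>K. F k < c"
  using boundingD[OF assms(1) card_le_image[OF assms(2)] assms(3)] by simp

lemma card_lessThan_mono: "v \<le> w \<Longrightarrow> |{..<v}| \<le>o |{..<w::'a::wellorder}|"
  by (rule card_of_mono1) auto

lemma bounding_mono: "bounding w D \<Longrightarrow> |{..<v}| \<le>o |{..<w}| \<Longrightarrow> bounding v D"
  unfolding bounding_def using ordLeq_transitive by blast

text \<open>Regularity of successor cardinals: \<open>X\<close> together with the segments below its
  points has size at most \<open>|v|\<close>, so some point of \<open>D\<close> lies outside, and
  such a point is above all of \<open>X\<close>.\<close>

lemma bounding_of_card: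
  fixes v :: "'a::wellorder"
  assumes "\<And>x. x \<in> D \<Longrightarrow> |{..<x}| \<le>o |{..<v}|" "infinite {..<v}" "\<not> |D| \<le>o |{..<v}|"
  shows "bounding v D"
  unfolding bounding_def
proof (intro allI impI)
  fix X assume X: "X \<subseteq> D" "|X| \<le>o |{..<v}|"
  have "|\<Union>x\<in>X. {..<x}| \<le>o |{..<v}|"
    using card_of_UNION_ordLeq_infinite[OF assms(2) X(2)] X(1) assms(1) by blast
  then have "|(\<Union>x\<in>X. {..<x}) \<union> X| \<le>o |{..<v}|"
    using card_le_Un[OF assms(2) _ X(2)] by blast
  then have "\<not> D \<subseteq> (\<Union>x\<in>X. {..<x}) \<union> X"
    using assms(3) card_of_mono1 ordLeq_transitive by blast
  then obtain c where "c \<in> D" "c \<notin> X" "\<forall>x\<in>X. \<not> c < x" by auto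
  then have "\<forall>x\<in>X. x < c" by (metis linorder_neqE)
  then show "\<exists>c\<in>D. \<forall>x\<in>X. x < c" using \<open>c \<in> D\<close> by auto
qed

lemma cf_cofinal_map:
  fixes \<delta> :: "'a::wellorder"
  shows "\<exists>g. (\<forall>i<cf \<delta>. g i < \<delta>) \<and> (\<forall>x<\<delta>. \<exists>i<cf \<delta>. x \<le> g i)"
proof -
  have "\<exists>g. (\<forall>i<\<delta>. g i < \<delta>) \<and> (\<forall>x<\<delta>. \<exists>i<\<delta>. x \<le> g i)"
    by (rule exI[of _ "\<lambda>x. x"]) auto
  then show ?thesis
    unfolding cf_def by (rule LeastI)
qed

lemma cf_le: "(\<And>i. i < v \<Longrightarrow> g i < \<delta>) \<Longrightarrow> (\<And>x. x < \<delta> \<Longrightarrow> \<exists>i<v. x \<le> g i) \<Longrightarrow> cf \<delta> \<le> v"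
  unfolding cf_def by (rule Least_le) blast

lemma bounding_below_cf:
  fixes \<delta> :: "'a::wellorder"
  assumes "v < cf \<delta>"
  shows "bounding v {..<\<delta>}"
  unfolding bounding_def
proof (intro allI impI, rule ccontr)
  fix X assume X: "X \<subseteq> {..<\<delta>}" "|X| \<le>o |{..<v}|" and n: "\<not> (\<exists>c\<in>{..<\<delta>}. \<forall>x\<in>X. x < c)"
  have cof: "\<exists>y\<in>X. x \<le> y" if "x < \<delta>" for x using n that by (auto simp: not_less)
  show False
  proof (cases "X = {}")
    case True
    then have "cf \<delta> \<le> \<delta>" by (intro cf_le[of \<delta> "\<lambda>x. x"]) auto
    moreover have "\<delta> \<le> v" using True cof by (metis empty_iff not_le)
    ultimately show False using assms by simp
  next
    case False
    then obtain g where "g ` {..<v} = X"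
      using card_of_ordLeq2[of X "{..<v}"] X(2) by auto
    then have "cf \<delta> \<le> v"
      using X(1) cof by (intro cf_le[of v g]) force+
    then show False using assms by simp
  qed
qed

lemma bounding_le_cf: "bounding v {..<\<delta>} \<Longrightarrow> v < cf \<delta>"
  for \<delta> :: "'a::wellorder"
proof (rule ccontr)
  assume b: "bounding v {..<\<delta>}" and "\<not> v < cf \<delta>"
  then have c: "|{..<cf \<delta>}| \<le>o |{..<v}|" by (intro card_lessThan_mono) simp
  obtain g where g0: "\<forall>i<cf \<delta>. g i < \<delta>" "\<forall>x<\<delta>. \<exists>i<cf \<delta>. x \<le> g i"
    using cf_cofinal_map[of \<delta>] by blast
  note g = g0[rule_format]
  obtain c where "c < \<delta>" "\<And>i. i < cf \<delta> \<Longrightarrow> g i < c"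
    using bounding_image[OF b c, of g] g(1) by auto
  then show False using g(2) by fastforce
qed

text \<open>The successor cardinal of \<open>|v|\<close> as an ordinal; \<open>v\<close> need not be
  a cardinal.\<close>

definition nextc :: "'a::wellorder \<Rightarrow> 'a" where
  "nextc v = (LEAST w. \<not> |{..<w}| \<le>o |{..<v}| )"

definition ssup :: "'a::wellorder set \<Rightarrow> 'a" where
  "ssup X = (LEAST b. \<forall>x\<in>X. x < b)"

lemma ssup_upper: "\<forall>x\<in>X. x < c \<Longrightarrow> x \<in> X \<Longrightarrow> x < ssup X"
  unfolding ssup_def by (rule LeastI2[of _ c]) auto

lemma ssup_le: "(\<And>x. x \<in> X \<Longrightarrow> x < c) \<Longrightarrow> ssup X \<le> c"
  unfolding ssup_def by (rule Least_le) auto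

lemma less_ssup: "y < ssup X \<Longrightarrow> \<exists>x\<in>X. y \<le> x"
  unfolding ssup_def using not_less_Least not_less by blast

lemma limit_of_card_below:
  fixes \<kappa> :: "'a::wellorder"
  assumes "infinite {..<\<kappa>}" "\<And>x. x < \<kappa> \<Longrightarrow> \<not> |{..<\<kappa>}| \<le>o |{..<x}|" "x < \<kappa>"
  shows "\<exists>y. x < y \<and> y < \<kappa>"
proof (rule ccontr)
  assume n: "\<not> ?thesis"
  have sub: "{..<\<kappa>} \<subseteq> insert x {..<x}"
  proof
    fix y assume "y \<in> {..<\<kappa>}"
    then show "y \<in> insert x {..<x}" using n by (cases y x rule: linorder_cases) auto
  qed
  have inf: "infinite {..<x}"
    using finite_subset[OF sub] assms(1) by auto
  have "|{..<\<kappa>}| \<le>o |{..<x}|"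
    by (rule card_le_subset[OF sub card_le_insert[OF inf card_le_refl]])
  then show False using assms(2,3) by blast
qed

section \<open>Consequences of \<mu> being singular and of the type having order type
  \<mu>^+\<close>

locale singular_successor =
  fixes \<mu> :: "'a::wellorder"
  assumes sing: "singular_cardinal \<mu>"
    and succ: "is_successor_of TYPE('a) \<mu>"
begin

abbreviation \<theta> :: 'a where "\<theta> \<equiv> cf \<mu>"

lemma infinite_mu: "infinite {..<\<mu>}" and cf_mu: "\<theta> < \<mu>" and Card_mu: "Card_order (le_on {..<\<mu>})"
  using sing by (auto simp: singular_cardinal_def)

lemma card_below_mu: "v < \<mu> \<Longrightarrow> \<not> |{..<\<mu>}| \<le>o |{..<v}|"
  using not_card_le_segment[OF Card_mu, of v] Int_absorb1[of "{..<v}" "{..<\<mu>}"] not_ordLess_ordLeq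
  by auto

lemma Card_UNIV: "Card_order (le_on (UNIV :: 'a set))"
  using succ cardSuc_Card_order[OF Card_mu] Card_order_ordIso unfolding is_successor_of_def by blast

lemma card_UNIV_eq: "|UNIV :: 'a set| =o cardSuc (le_on {..<\<mu>})"
  using card_of_Field_ordIso[OF Card_UNIV] succ ordIso_transitive
  unfolding is_successor_of_def by fastforce

lemma card_le_mu_iff: "|A :: 'b set| \<le>o |{..<\<mu>}| \<longleftrightarrow> |A| <o |UNIV :: 'a set|"
proof -
  have "|A| <o |UNIV :: 'a set| \<longleftrightarrow> |A| <o cardSuc (le_on {..<\<mu>})"
    using ordLess_ordIso_trans[OF _ card_UNIV_eq] ordLess_ordIso_trans[OF _ ordIso_symmetric[OF card_UNIV_eq]]
    by blast
  also have "\<dots> \<longleftrightarrow> |A| \<le>o le_on {..<\<mu>}"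
    using cardSuc_ordLeq_ordLess[OF Card_mu card_of_Card_order] by blast
  also have "\<dots> \<longleftrightarrow> |A| \<le>o |{..<\<mu>}|"
    using card_of_Field_ordIso[OF Card_mu] ordLeq_ordIso_trans ordIso_symmetric by fastforce
  finally show ?thesis by blast
qed

lemma card_segment_le: "|{..<x::'a}| \<le>o |{..<\<mu>}|"
  using not_card_le_segment[OF Card_UNIV, of x] card_le_mu_iff by auto

lemma card_UNIV_not_le: "\<not> |UNIV :: 'a set| \<le>o |{..<\<mu>}|"
  using card_le_mu_iff ordLess_irreflexive by blast

lemma bounding_UNIV: "bounding \<mu> UNIV"
  by (rule bounding_of_card[OF card_segment_le infinite_mu card_UNIV_not_le])

lemma UNIV_no_max: "\<exists>y::'a. x < y"
proof -
  have "|{x}| \<le>o |{..<\<mu>}|" using infinite_mu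
    by (intro card_le_finite) auto
  then show ?thesis using boundingD[OF bounding_UNIV, of "{x}"] by blast
qed

lemma ssup_upper_UNIV: "|X| \<le>o |{..<\<mu>}| \<Longrightarrow> x \<in> X \<Longrightarrow> x < ssup (X :: 'a set)"
  using ssup_upper boundingD[OF bounding_UNIV, of X] by (metis subset_UNIV)

lemma nextc_le: "v < \<mu> \<Longrightarrow> nextc v \<le> \<mu>"
  unfolding nextc_def by (rule Least_le) (rule card_below_mu)

lemma nextc_not_le: "v < \<mu> \<Longrightarrow> \<not> |{..<nextc v}| \<le>o |{..<v}|"
  unfolding nextc_def by (rule LeastI) (rule card_below_mu)

lemma less_nextc: "x < nextc v \<Longrightarrow> |{..<x}| \<le>o |{..<v}|"
  unfolding nextc_def using not_less_Least by blast

lemma nextc_gt: "v < \<mu> \<Longrightarrow> v < nextc v"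
  using nextc_not_le card_lessThan_mono not_less by blast

lemma bounding_nextc: "v < \<mu> \<Longrightarrow> infinite {..<v} \<Longrightarrow> bounding v {..<nextc v}"
  by (rule bounding_of_card) (auto simp: less_nextc nextc_not_le)

text \<open>Otherwise \<mu> would be the successor of \<open>|v|\<close> and so could not have the
  cofinal subset of size \<open>|\<theta>| \<le> |v|\<close> that singularity provides.\<close>

lemma nextc_less: 
  assumes "v < \<mu>" "infinite {..<v}"
  shows "nextc v < \<mu>"
proof (rule ccontr)
  assume "\<not> ?thesis"
  then have eq: "nextc v = \<mu>" using nextc_le[OF assms(1)] by simp
  then have "|{..<\<theta>}| \<le>o |{..<v}|" using less_nextc cf_mu by metis
  then have "bounding \<theta> {..<\<mu>}"
    using bounding_mono[OF bounding_nextc[OF assms]] eq by simp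
  then show False using bounding_le_cf by blast
qed

lemma infinite_mono: "v \<le> w \<Longrightarrow> infinite {..<v} \<Longrightarrow> infinite {..<w::'a}"
  by (meson finite_subset lessThan_subset_iff)

lemma mu_limit: "x < \<mu> \<Longrightarrow> \<exists>y. x < y \<and> y < \<mu>"
  using limit_of_card_below[OF infinite_mu card_below_mu] .

lemma infinite_cf: "infinite {..<\<theta>}"
proof
  assume f: "finite {..<\<theta>}"
  obtain g where g0: "\<forall>i<\<theta>. g i < \<mu>" "\<forall>x<\<mu>. \<exists>i<\<theta>. x \<le> g i"
    using cf_cofinal_map[of \<mu>] by blast
  note g = g0[rule_format]
  obtain z where z: "z < \<mu>" using infinite_mu by (metis finite.emptyI lessThan_iff ex_in_conv)
  have "Max (insert z (g ` {..<\<theta>})) \<in> insert z (g ` {..<\<theta>})" using f by (intro Max_in) auto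
  then have "Max (insert z (g ` {..<\<theta>})) < \<mu>" using g z by auto
  then obtain y where y: "y < \<mu>" "Max (insert z (g ` {..<\<theta>})) < y" using mu_limit by blast
  then obtain i where "i < \<theta>" "y \<le> g i" using g by blast
  moreover have "g i \<le> Max (insert z (g ` {..<\<theta>}))" using f \<open>i < \<theta>\<close> by simp
  ultimately show False using y by simp
qed

lemma card_below_cf: "x < \<theta> \<Longrightarrow> \<not> |{..<\<theta>}| \<le>o |{..<x}|"
proof
  assume x: "x < \<theta>" and l: "|{..<\<theta>}| \<le>o |{..<x}|"
  then have "bounding \<theta> {..<\<mu>}" using bounding_mono[OF bounding_below_cf] by blast
  then show False using bounding_le_cf by blast
qed

lemma bounding_mu: "v < \<theta> \<Longrightarrow> bounding v {..<\<mu>}"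
  by (rule bounding_below_cf)

text \<open>Strict suprema of initial parts of a cofinal map stay below \<mu>, since each part is
  shorter than \<open>cf \<mu>\<close>. Putting \<theta> into every supremum makes all the
  \<open>\<nu> i\<close> infinite.\<close>

lemma exists_cofinal_mono:
  "\<exists>\<nu>. (\<forall>i<\<theta>. \<nu> i < \<mu> \<and> \<theta> \<le> \<nu> i) \<and> (\<forall>x<\<mu>. \<exists>i<\<theta>. x < \<nu> i)
    \<and> (\<forall>i j. i \<le> j \<longrightarrow> j < \<theta> \<longrightarrow> \<nu> i \<le> \<nu> j)"
proof -
  obtain g where g0: "\<forall>i<\<theta>. g i < \<mu>" "\<forall>x<\<mu>. \<exists>i<\<theta>. x \<le> g i"
    using cf_cofinal_map[of \<mu>] by blast
  note g = g0[rule_format]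
  define \<nu> where "\<nu> i = ssup (insert \<theta> (g ` {..i}))" for i
  have bd: "\<exists>c<\<mu>. \<forall>x\<in>insert \<theta> (g ` {..i}). x < c" if i: "i < \<theta>" for i
  proof -
    have "\<exists>c\<in>{..<\<mu>}. \<forall>k\<in>{..<i}. g k < c"
      using g(1) i by (intro bounding_image[OF bounding_mu[OF i] card_le_refl]) auto
    then obtain c where "c < \<mu>" "\<forall>k<i. g k < c" by auto
    moreover obtain d where "d < \<mu>" "max \<theta> (max c (g i)) < d"
      using mu_limit[of "max \<theta> (max c (g i))"] g(1)[OF i] \<open>c < \<mu>\<close> cf_mu by auto
    ultimately show ?thesis
      by (intro exI[of _ d]) (auto simp: le_less dest: less_trans)
  qed
  have up: "x < \<nu> i" if "i < \<theta>" "x \<in> insert \<theta> (g ` {..i})" for i x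
    unfolding \<nu>_def using ssup_upper bd[OF that(1)] that(2) by meson
  have "\<nu> i < \<mu>" if i: "i < \<theta>" for i
  proof -
    obtain c where c: "c < \<mu>" "\<forall>x\<in>insert \<theta> (g ` {..i}). x < c" using bd[OF i] by blast
    have "\<nu> i \<le> c" unfolding \<nu>_def using c(2) by (intro ssup_le) blast
    then show ?thesis using c(1) by simp
  qed
  moreover have "\<exists>i<\<theta>. x < \<nu> i" if x: "x < \<mu>" for x
  proof -
    obtain i where i: "i < \<theta>" "x \<le> g i" using g(2)[OF x] by blast
    moreover have "g i < \<nu> i" by (rule up[OF i(1)]) simp
    ultimately show ?thesis by (intro exI[of _ i]) simp
  qed
  moreover have "\<nu> i \<le> \<nu> j" if "i \<le> j" "j < \<theta>" for i j
    unfolding \<nu>_def[of i] using that by (intro ssup_le up) auto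
  moreover have "\<theta> \<le> \<nu> i" if "i < \<theta>" for i using up[OF that] by (simp add: less_imp_le)
  ultimately show ?thesis by (intro exI[of _ \<nu>]) simp
qed

text \<open>Regularity of \<theta>, pulled back from \<mu>: the image of a short \<open>X\<close>
  under the monotone map \<nu> is bounded in \<mu>, and \<nu> exceeds that bound somewhere.\<close>

lemma bounding_cf: "v < \<theta> \<Longrightarrow> bounding v {..<\<theta>}"
proof -
  assume v: "v < \<theta>"
  obtain \<nu> where n: "\<And>i. i < \<theta> \<Longrightarrow> \<nu> i < \<mu>" "\<And>x. x < \<mu> \<Longrightarrow> \<exists>i<\<theta>. x < \<nu> i"
    "\<And>i j. i \<le> j \<Longrightarrow> j < \<theta> \<Longrightarrow> \<nu> i \<le> \<nu> j"
    using exists_cofinal_mono by auto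
  show ?thesis unfolding bounding_def
  proof (intro allI impI)
    fix X assume X: "X \<subseteq> {..<\<theta>}" "|X| \<le>o |{..<v}|"
    have "\<exists>c\<in>{..<\<mu>}. \<forall>x\<in>X. \<nu> x < c"
      using X(1) n(1) by (intro bounding_image[OF bounding_mu[OF v] X(2)]) auto
    then obtain c where c: "c < \<mu>" "\<And>x. x \<in> X \<Longrightarrow> \<nu> x < c" by auto
    then obtain i where "i < \<theta>" "c < \<nu> i" using n(2) by blast
    have "\<forall>x\<in>X. x < i"
    proof (intro ballI, rule ccontr)
      fix x assume "x \<in> X" "\<not> x < i"
      then have "\<nu> i \<le> \<nu> x" using n(3) X(1) by auto
      then show False using c(2)[OF \<open>x \<in> X\<close>] \<open>c < \<nu> i\<close> by simp
    qed
    then show "\<exists>c\<in>{..<\<theta>}. \<forall>x\<in>X. x < c" using \<open>i < \<theta>\<close> by blast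
  qed
qed

lemma bounding_cf': 
  assumes "|B| <o |{..<\<theta>}|" 
  obtains v where "v < \<theta>" "|B| \<le>o |{..<v}|" "bounding v {..<\<theta>}" "bounding v {..<\<mu>}"
  using card_less_segment[OF assms] bounding_cf bounding_mu by metis

lemma cf_limit: "x < \<theta> \<Longrightarrow> \<exists>y. x < y \<and> y < \<theta>"
  using limit_of_card_below[OF infinite_cf card_below_cf] .

end

section \<open>Club guessing\<close>

text \<open>The functional sees \<open>undefined\<close> from \<open>i\<close> on; each application
  therefore has to show that its functional ignores those values.\<close>

lemma wellorder_recursion:
  fixes H :: "('a::wellorder \<Rightarrow> 'b) \<Rightarrow> 'a \<Rightarrow> 'b"
  shows "\<exists>f. \<forall>i. f i = H (\<lambda>j. if j < i then f j else undefined) i"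
  using wfrec[OF wf, of H] by (intro exI[of _ "wfrec {(x, y). x < y} H"]) (auto simp: cut_def)

text \<open>Abstracts what is common to \<open>D = {..<\<kappa>}\<close> for \<open>\<kappa>\<close> the successor cardinal of \<open>v\<close>,
  and to \<open>D = UNIV\<close>.\<close>

definition succ_like :: "'a::wellorder \<Rightarrow> 'a set \<Rightarrow> bool" where
  "succ_like v D \<longleftrightarrow> infinite {..<v} \<and> bounding v D \<and> (\<forall>x\<in>D. |{..<x}| \<le>o |{..<v}| \<and> {..<x} \<subseteq> D)"

lemma succ_like_downward: "succ_like v D \<Longrightarrow> c \<in> D \<Longrightarrow> a \<le> c \<Longrightarrow> a \<in> D"
  by (cases "a = c") (auto simp: succ_like_def subset_iff)

lemma succ_like_above:
  assumes "succ_like v D" "x \<in> D" "F ` D \<subseteq> D"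
  shows "\<exists>c\<in>D. x < c \<and> (\<forall>y\<le>x. F y < c)"
proof -
  have eq: "{..x} = insert x {..<x}" by (rule set_eqI) (simp add: le_less disj_commute)
  have "|{..x}| \<le>o |{..<v}|"
    using assms(1,2) unfolding eq succ_like_def by (intro card_le_insert) simp_all
  then have *: "|insert x (F ` {..x})| \<le>o |{..<v}|"
    using assms(1) \<open>|{..x}| \<le>o |{..<v}|\<close>
    unfolding succ_like_def by (intro card_le_insert card_le_image) simp_all
  have "{..x} \<subseteq> D"
    using assms(1,2) unfolding eq succ_like_def by simp
  then have "\<exists>c\<in>D. \<forall>y\<in>insert x (F ` {..x}). y < c"
    using assms(1,2,3) * unfolding succ_like_def by (intro boundingD[of v]) auto
  then show ?thesis by auto
qed

definition closure_points :: "('a::wellorder \<Rightarrow> 'a) \<Rightarrow> 'a set \<Rightarrow> 'a set" where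
  "closure_points F D = {\<gamma>\<in>D. (\<exists>x. x < \<gamma>) \<and> (\<forall>x<\<gamma>. \<exists>y<\<gamma>. x < y \<and> F x < y)}"

text \<open>Iterate \<omega> times a step that passes all earlier values of \<open>F\<close>; the
  supremum stays in \<open>D\<close> because \<open>v\<close> is infinite, so that \<open>D\<close>
  bounds countable sets.\<close>

lemma closure_points_club:
  assumes D: "succ_like v D" and F: "F ` D \<subseteq> D"
  shows "club_in D (closure_points F D)"
  unfolding club_in_def
proof (intro conjI ballI impI)
  show "closure_points F D \<subseteq> D" by (auto simp: closure_points_def)
next
  fix x assume x: "x \<in> D"
  define nx where "nx y = (SOME c. c \<in> D \<and> y < c \<and> (\<forall>z\<le>y. F z < c))" for y
  have nx: "nx y \<in> D \<and> y < nx y \<and> (\<forall>z\<le>y. F z < nx y)" if "y \<in> D" for y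
    unfolding nx_def using someI_ex[of "\<lambda>c. c \<in> D \<and> y < c \<and> (\<forall>z\<le>y. F z < c)"]
      succ_like_above[OF D that F] by auto
  define s where "s n = (nx ^^ n) x" for n
  have s: "s n \<in> D" for n by (induction n) (auto simp: s_def x nx)
  have s': "s n < s (Suc n) \<and> (\<forall>z\<le>s n. F z < s (Suc n))" for n
    using nx[OF s[of n]] by (simp add: s_def)
  have inf: "infinite {..<v}" using D by (simp add: succ_like_def)
  have "|range s| \<le>o |{..<v}|"
    using card_le_image[of "UNIV::nat set" "{..<v}" s] infinite_iff_card_of_nat inf by blast
  then have "\<exists>c\<in>D. \<forall>y\<in>range s. y < c"
    using D s by (intro boundingD[of v]) (auto simp: succ_like_def)
  then obtain c where c: "c \<in> D" "\<forall>y\<in>range s. y < c" by blast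
  define g where "g = ssup (range s)"
  have up: "s n < g" for n unfolding g_def by (rule ssup_upper[OF c(2)]) simp
  have "g \<le> c" unfolding g_def using c(2) by (intro ssup_le) auto
  then have "g \<in> D" using c(1) succ_like_downward[OF D] by blast
  moreover have "\<exists>y<g. z < y \<and> F z < y" if "z < g" for z
  proof -
    have "z < ssup (range s)" using that by (simp add: g_def)
    then obtain n where "z \<le> s n" using less_ssup[of z "range s"] by blast
    then show ?thesis using s'[of n] up[of "Suc n"] by (meson le_less_trans)
  qed
  ultimately have "g \<in> closure_points F D"
    using up[of 0] by (auto simp: closure_points_def)
  moreover have "x \<le> g" using up[of 0] by (simp add: s_def less_imp_le)
  ultimately show "\<exists>c\<in>closure_points F D. x \<le> c" by blast
next
  fix a assume a: "a \<in> D" "(\<exists>x. x < a) \<and> (\<forall>x<a. \<exists>c\<in>closure_points F D. x < c \<and> c < a)"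
  have "\<exists>y<a. z < y \<and> F z < y" if z: "z < a" for z
  proof -
    obtain c where "c \<in> closure_points F D" "z < c" "c < a" using a z by blast
    then obtain y where "y < c" "z < y" "F z < y" by (auto simp: closure_points_def)
    then show ?thesis using \<open>c < a\<close> by (intro exI[of _ y]) simp
  qed
  then show "a \<in> closure_points F D" using a by (auto simp: closure_points_def)
qed

lemma club_in_above:
  assumes "succ_like v D" "club_in D E" "x \<in> D"
  shows "\<exists>e\<in>E. x < e"
proof -
  obtain c where "c \<in> D" "x < c" using succ_like_above[of v D x "\<lambda>x. x"] assms by auto
  then show ?thesis using assms(2) unfolding club_in_def by (meson less_le_trans)
qed

text \<open>Let \<open>F y\<close> bound the next points after \<open>y\<close> of all the
  \<open>E k\<close>; a closure point of \<open>F\<close> is a limit of every \<open>E k\<close>.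
  The factor \<open>D\<close> gives the right value for empty \<open>K\<close>.\<close>

lemma club_in_Inter:
  assumes D: "succ_like v D" and K: "|K| \<le>o |{..<v}|" and E: "\<And>k. k \<in> K \<Longrightarrow> club_in D (E k)"
  shows "club_in D (D \<inter> (\<Inter>k\<in>K. E k))"
  unfolding club_in_def
proof (intro conjI ballI impI)
  show "D \<inter> (\<Inter>k\<in>K. E k) \<subseteq> D" by auto
next
  fix x assume x: "x \<in> D"
  define nx where "nx k y = (SOME e. e \<in> E k \<and> y < e)" for k y
  have nx: "nx k y \<in> E k \<and> y < nx k y" if "k \<in> K" "y \<in> D" for k y
    unfolding nx_def using someI_ex[of "\<lambda>e. e \<in> E k \<and> y < e"] club_in_above[OF D E[OF that(1)] that(2)] by auto
  define F where "F y = (SOME c. c \<in> D \<and> (\<forall>k\<in>K. nx k y < c))" for y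
  have F: "F y \<in> D \<and> (\<forall>k\<in>K. nx k y < F y)" if "y \<in> D" for y
  proof -
    have "\<exists>c\<in>D. \<forall>k\<in>K. nx k y < c"
      using D nx[OF _ that] E unfolding succ_like_def club_in_def
      by (intro bounding_image[OF _ K]) blast+
    then show ?thesis
      unfolding F_def using someI_ex[of "\<lambda>c. c \<in> D \<and> (\<forall>k\<in>K. nx k y < c)"] by auto
  qed
  have "club_in D (closure_points F D)" using closure_points_club[OF D] F by blast
  then obtain g where g: "g \<in> closure_points F D" "x \<le> g" using x unfolding club_in_def by blast
  have gD: "g \<in> D" "{..<g} \<subseteq> D" using g D by (auto simp: closure_points_def succ_like_def)
  have "g \<in> E k" if k: "k \<in> K" for k
  proof -
    have "\<exists>c\<in>E k. z < c \<and> c < g" if z: "z < g" for z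
    proof -
      have "z \<in> D" using gD z by auto
      moreover obtain y where "y < g" "F z < y" using g z by (auto simp: closure_points_def)
      ultimately show ?thesis using nx[OF k, of z] F[of z] k by (meson less_trans)
    qed
    moreover have "\<exists>x. x < g" using g by (auto simp: closure_points_def)
    ultimately show ?thesis using E[OF k] gD(1) unfolding club_in_def by blast
  qed
  then show "\<exists>c\<in>D \<inter> (\<Inter>k\<in>K. E k). x \<le> c" using g gD by blast
next
  fix a assume a: "a \<in> D" "(\<exists>x. x < a) \<and> (\<forall>x<a. \<exists>c\<in>D \<inter> (\<Inter>k\<in>K. E k). x < c \<and> c < a)"
  have "a \<in> E k" if "k \<in> K" for k
  proof -
    have "\<forall>x<a. \<exists>c\<in>E k. x < c \<and> c < a" using a that by blast
    then show ?thesis using E[OF that] a unfolding club_in_def by blast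
  qed
  then show "a \<in> D \<inter> (\<Inter>k\<in>K. E k)" using a by blast
qed

lemma osup_le: "(\<And>x. x \<in> A \<Longrightarrow> x \<le> c) \<Longrightarrow> osup A \<le> c"
  unfolding osup_def by (rule Least_le) auto

lemma osup_upper: "\<forall>x\<in>A. x \<le> c \<Longrightarrow> x \<in> A \<Longrightarrow> x \<le> osup A"
  unfolding osup_def by (rule LeastI2[of _ c]) auto

lemma osup_segment_upper: "e \<in> E \<Longrightarrow> e \<le> x \<Longrightarrow> e \<le> osup (E \<inter> {..x})"
  by (rule osup_upper[of _ x]) auto

text \<open>A supremum that is not attained is a limit of \<open>E\<close>. The premise on
  \<open>z\<close> excludes the supremum 0 of an empty set, which need not lie in
  \<open>E\<close>.\<close>

lemma osup_segment_in_club: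
  assumes E: "club_in D E" and D: "\<And>x. x \<in> D \<Longrightarrow> {..<x} \<subseteq> D" and x: "x \<in> D" and ne: "z < osup (E \<inter> {..x})"
  shows "osup (E \<inter> {..x}) \<in> E"
proof (rule ccontr)
  let ?u = "osup (E \<inter> {..x})"
  assume n: "?u \<notin> E"
  have "?u \<le> x" by (rule osup_le) auto
  then have "?u \<in> D" using D[OF x] x by (cases "?u = x") auto
  moreover have "\<exists>c\<in>E. y < c \<and> c < ?u" if y: "y < ?u" for y
  proof -
    have "\<exists>e\<in>E \<inter> {..x}. y < e"
    proof (rule ccontr)
      assume "\<not> ?thesis"
      then have "?u \<le> y" by (intro osup_le) (auto simp: not_less)
      then show False using y by simp
    qed
    then obtain e where "e \<in> E" "e \<le> x" "y < e" by auto
    moreover from this have "e \<le> ?u" by (intro osup_segment_upper)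
    ultimately show ?thesis using n by (metis order.not_eq_order_implies_strict)
  qed
  ultimately show False using E n ne unfolding club_in_def by blast
qed

context singular_successor
begin

lemma succ_like_UNIV: "succ_like \<mu> UNIV"
  using infinite_mu bounding_UNIV card_segment_le by (auto simp: succ_like_def)

lemma succ_like_nextc: "v < \<mu> \<Longrightarrow> infinite {..<v} \<Longrightarrow> succ_like v {..<nextc v}"
  using bounding_nextc less_nextc by (auto simp: succ_like_def)

lemma infinite_nextc: "v < \<mu> \<Longrightarrow> infinite {..<v} \<Longrightarrow> infinite {..<nextc v}"
  using infinite_mono nextc_gt less_imp_le by blast

lemma club_guessing_point:
  assumes v: "v < \<mu>" "infinite {..<v}" and D: "succ_like w D" and w: "nextc v \<le> w"
    and E: "club_in D E"
  shows "\<exists>a\<in>D. bounding v {..<a} \<and> (\<exists>c\<subseteq>{..<a}. |c| \<le>o |{..<nextc v}| \<and> (\<forall>x<a. \<exists>y\<in>c. x \<le> y))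
    \<and> (\<forall>x<a. \<exists>e\<in>E. x < e \<and> e < a)"
proof -
  let ?\<tau> = "nextc v"
  \<comment> \<open>A strictly increasing sequence of length \<open>nextc v\<close> through
    \<open>E\<close>; its supremum \<open>a\<close> has the cofinality of
    \<open>nextc v\<close>.\<close>
  define H where "H f i = (SOME e. e \<in> E \<and> (\<forall>j<i. f j < e))" for f and i :: 'a
  obtain z where z: "\<forall>i. z i = H (\<lambda>j. if j < i then z j else undefined) i"
    using wellorder_recursion[of H] by (rule exE)
  have z1: "z i = (SOME e. e \<in> E \<and> (\<forall>j<i. z j < e))" for i
  proof -
    have "H (\<lambda>j. if j < i then z j else undefined) i = (SOME e. e \<in> E \<and> (\<forall>j<i. z j < e))"
      unfolding H_def by (rule arg_cong[where f = Eps]) auto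
    then show ?thesis using z by simp
  qed
  have z2: "z i \<in> E \<and> (\<forall>j<i. z j < z i)" if "i < ?\<tau>" for i
    using that
  proof (induction i rule: less_induct)
    case (less i)
    have "|{..<i}| \<le>o |{..<w}|"
      using less.prems w by (intro card_lessThan_mono) simp
    moreover have "z ` {..<i} \<subseteq> D" using less E by (auto simp: club_in_def)
    ultimately have "\<exists>c\<in>D. \<forall>j\<in>{..<i}. z j < c"
      using D by (intro bounding_image[of w]) (auto simp: succ_like_def)
    then obtain c where "c \<in> D" "\<forall>j<i. z j < c" by auto
    moreover from this obtain e where "e \<in> E" "c < e" using club_in_above[OF D E] by blast
    ultimately have "\<exists>e. e \<in> E \<and> (\<forall>j<i. z j < e)" by (intro exI[of _ e]) (auto intro: less_trans)
    then show ?case unfolding z1[of i] by (rule someI_ex)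
  qed
  have "\<exists>c\<in>D. \<forall>j\<in>{..<?\<tau>}. z j < c"
    using D z2 E w by (intro bounding_image[of w] card_lessThan_mono) (auto simp: succ_like_def club_in_def)
  then obtain c where c: "c \<in> D" "\<forall>x\<in>z ` {..<?\<tau>}. x < c" by auto
  define a where "a = ssup (z ` {..<?\<tau>})"
  have up: "z i < a" if "i < ?\<tau>" for i
    unfolding a_def by (rule ssup_upper[OF c(2)]) (use that in simp)
  have low: "\<exists>i<?\<tau>. x \<le> z i" if "x < a" for x
    using less_ssup[of x "z ` {..<?\<tau>}"] that a_def by auto
  have "a \<le> c" unfolding a_def using c(2) by (intro ssup_le) auto
  then have "a \<in> D" using c(1) succ_like_downward[OF D] by blast
  moreover have "bounding v {..<a}"
    unfolding bounding_def
  proof (intro allI impI)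
    fix X assume X: "X \<subseteq> {..<a}" "|X| \<le>o |{..<v}|"
    have "\<forall>x\<in>X. \<exists>i<?\<tau>. x \<le> z i" using low X(1) by auto
    then obtain k where k: "\<forall>x\<in>X. k x < ?\<tau> \<and> x \<le> z (k x)" by metis
    have "\<exists>i\<in>{..<?\<tau>}. \<forall>x\<in>X. k x < i"
      using k by (intro bounding_image[OF bounding_nextc[OF v] X(2)]) auto
    then obtain i where "i < ?\<tau>" "\<forall>x\<in>X. k x < i" by auto
    then show "\<exists>c\<in>{..<a}. \<forall>x\<in>X. x < c"
      using k z2[of i] up[of i] by (intro bexI[of _ "z i"]) (auto dest: le_less_trans)
  qed
  moreover have "\<exists>c\<subseteq>{..<a}. |c| \<le>o |{..<?\<tau>}| \<and> (\<forall>x<a. \<exists>y\<in>c. x \<le> y)"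
    using up low by (intro exI[of _ "z ` {..<?\<tau>}"]) (auto intro: card_of_image)
  moreover have "\<exists>e\<in>E. x < e \<and> e < a" if "x < a" for x
  proof -
    obtain i where i: "i < ?\<tau>" "x \<le> z i" using low[OF \<open>x < a\<close>] by auto
    obtain j where "i < j" "j < ?\<tau>"
      using succ_like_above[OF succ_like_nextc[OF v], of i "\<lambda>x. x"] i by auto
    then show ?thesis using z2[of j] up[of j] i by (meson le_less_trans)
  qed
  ultimately show ?thesis by blast
qed

text \<open>The three successors: the guessing points have cofinality \<open>nextc v\<close>, a
  wrong guess is corrected \<open>nextc (nextc v)\<close> times, which is more often than a ladder
  has points, and the intersection of that many clubs must still be a club.\<close>

lemma club_guessing:
  assumes v: "v < \<mu>" "infinite {..<v}"
  defines "\<kappa> \<equiv> nextc (nextc (nextc v))"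
  shows "\<exists>\<C>. |\<C>| \<le>o |{..<\<kappa>}| \<and> (\<forall>c\<in>\<C>. c \<subseteq> {..<\<kappa>} \<and> bounding v c)
    \<and> (\<forall>E. club_in {..<\<kappa>} E \<longrightarrow> (\<exists>c\<in>\<C>. c \<subseteq> E))"
proof -
  define \<tau> where "\<tau> = nextc v"
  define \<tau>' where "\<tau>' = nextc \<tau>"
  have t: "\<tau> < \<mu>" "infinite {..<\<tau>}" "\<tau>' < \<mu>" "infinite {..<\<tau>'}" "\<tau> < \<tau>'"
    unfolding \<tau>_def \<tau>'_def using v by (auto simp: nextc_less infinite_nextc nextc_gt)
  define D where "D = {..<\<kappa>}"
  have D: "succ_like \<tau>' D"
    unfolding D_def \<kappa>_def \<tau>'_def \<tau>_def using t unfolding \<tau>'_def \<tau>_def by (intro succ_like_nextc)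
  have Dseg: "{..<x} \<subseteq> D" if "x \<in> D" for x using D that by (auto simp: succ_like_def)
  define P where "P a \<longleftrightarrow> a \<in> D \<and> bounding v {..<a} \<and>
    (\<exists>c\<subseteq>{..<a}. |c| \<le>o |{..<\<tau>}| \<and> (\<forall>x<a. \<exists>y\<in>c. x \<le> y))" for a
  define lim where "lim E a \<longleftrightarrow> (\<forall>x<a. \<exists>e\<in>E. x < e \<and> e < a)" for E :: "'a set" and a
  define L where "L a = (SOME c. c \<subseteq> {..<a} \<and> |c| \<le>o |{..<\<tau>}| \<and> (\<forall>x<a. \<exists>y\<in>c. x \<le> y))" for a :: 'a
  have L: "L a \<subseteq> {..<a} \<and> |L a| \<le>o |{..<\<tau>}| \<and> (\<forall>x<a. \<exists>y\<in>L a. x \<le> y)" if "P a" for a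
    unfolding L_def using that someI_ex[of "\<lambda>c. c \<subseteq> {..<a} \<and> |c| \<le>o |{..<\<tau>}| \<and> (\<forall>x<a. \<exists>y\<in>c. x \<le> y)"]
    unfolding P_def by auto
  define m where "m E x = osup (E \<inter> {..x})" for E and x :: 'a
  \<comment> \<open>Rounding the ladder down into \<open>E\<close>. The point 0 is dropped, since it
    is the value of \<open>osup\<close> when \<open>E\<close> has no element up to
    \<open>x\<close>.\<close>
  define G where "G E a = {y. (\<exists>z. z < y) \<and> (\<exists>x\<in>L a. y = m E x)}" for E a
  have G_bd: "bounding v (G E a)" "G E a \<subseteq> D" if "P a" "lim E a" for E a
  proof -
    have lt: "y < a" if "y \<in> G E a" for y
    proof -
      obtain x where "x \<in> L a" "y = m E x" using \<open>y \<in> G E a\<close> unfolding G_def by auto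
      moreover have "m E x \<le> x" unfolding m_def by (rule osup_le) auto
      ultimately show ?thesis using L[OF \<open>P a\<close>] by fastforce
    qed
    then show "G E a \<subseteq> D" using Dseg[of a] \<open>P a\<close> unfolding P_def by auto
    have cof: "\<exists>y\<in>G E a. x < y" if x: "x < a" for x
    proof -
      obtain e where e: "e \<in> E" "x < e" "e < a" using \<open>lim E a\<close> x unfolding lim_def by blast
      then obtain z where z: "z \<in> L a" "e \<le> z" using L[OF \<open>P a\<close>] by blast
      then have "e \<le> m E z" unfolding m_def using e by (intro osup_segment_upper)
      then have "x < m E z" using e by simp
      then show ?thesis using z by (intro bexI[of _ "m E z"]) (auto simp: G_def)
    qed
    show "bounding v (G E a)"
      unfolding bounding_def
    proof (intro allI impI)
      fix X assume X: "X \<subseteq> G E a" "|X| \<le>o |{..<v}|"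
      have "\<exists>c\<in>{..<a}. \<forall>x\<in>X. x < c"
        using \<open>P a\<close> X lt unfolding P_def by (intro boundingD[of v]) auto
      then obtain c where "c < a" "\<forall>x\<in>X. x < c" by auto
      moreover obtain y where "y \<in> G E a" "c < y" using cof[OF \<open>c < a\<close>] by blast
      ultimately show "\<exists>c\<in>G E a. \<forall>x\<in>X. x < c" by (meson less_trans)
    qed
  qed
  have "\<exists>E. club_in D E \<and> (\<forall>E'. club_in D E' \<longrightarrow> (\<exists>a. P a \<and> lim E a \<and> G E a \<subseteq> E'))"
  proof (rule ccontr)
    assume "\<not> ?thesis"
    then obtain N where N: "\<And>E. club_in D E \<Longrightarrow> club_in D (N E) \<and> (\<forall>a. P a \<longrightarrow> lim E a \<longrightarrow> \<not> G E a \<subseteq> N E)"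
      by metis
    \<comment> \<open>Correct by \<open>N\<close> transfinitely often. The clubs decrease, so for
      fixed \<open>x\<close> the ordinals \<open>m (E i) x\<close> decrease with \<open>i\<close>
      and must become constant.\<close>
    define H where "H f i = D \<inter> (\<Inter>j\<in>{..<i}. N (f j))" for f and i :: 'a
    obtain E where E0: "\<forall>i. E i = H (\<lambda>j. if j < i then E j else undefined) i"
      using wellorder_recursion[of H] by (rule exE)
    have "H (\<lambda>j. if j < i then E j else undefined) i = D \<inter> (\<Inter>j\<in>{..<i}. N (E j))" for i
      by (simp add: H_def)
    then have E: "E i = D \<inter> (\<Inter>j\<in>{..<i}. N (E j))" for i using E0 by metis
    have Ecl: "club_in D (E i)" if "i < \<tau>'" for i
      using that
    proof (induction i rule: less_induct)
      case (less i)
      show ?case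
        unfolding E[of i] using less N
        by (intro club_in_Inter[OF D] card_lessThan_mono) auto
    qed
    have anti: "E j \<subseteq> E i" if "i \<le> j" for i j
      using that unfolding E[of i] E[of j] by auto
    define E' where "E' = D \<inter> (\<Inter>i\<in>{..<\<tau>'}. E i)"
    have "club_in D E'" unfolding E'_def using Ecl by (intro club_in_Inter[OF D card_le_refl]) auto
    then obtain a where a: "P a" "lim E' a"
      using club_guessing_point[OF v D less_imp_le[OF t(5)[unfolded \<tau>_def]], of E']
      unfolding P_def lim_def \<tau>_def by blast
    have lim: "lim (E i) a" if "i < \<tau>'" for i
      using a(2) that unfolding lim_def E'_def by blast
    have mono: "m (E j) x \<le> m (E i) x" if "i \<le> j" for i j x
      unfolding m_def using anti[OF that] by (intro osup_le osup_segment_upper) auto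
    have "\<exists>i<\<tau>'. \<forall>j<\<tau>'. m (E i) x \<le> m (E j) x" for x
    proof -
      have "m (E v) x \<in> (\<lambda>i. m (E i) x) ` {..<\<tau>'}"
        using v(1) t(5) nextc_gt[of v] unfolding \<tau>_def by auto
      then have "(LEAST y. y \<in> (\<lambda>i. m (E i) x) ` {..<\<tau>'}) \<in> (\<lambda>i. m (E i) x) ` {..<\<tau>'}"
        by (rule LeastI)
      moreover have "(LEAST y. y \<in> (\<lambda>i. m (E i) x) ` {..<\<tau>'}) \<le> m (E j) x" if "j < \<tau>'" for j
        using that by (intro Least_le) auto
      ultimately show ?thesis by force
    qed
    then obtain k where k: "\<And>x. k x < \<tau>' \<and> (\<forall>j<\<tau>'. m (E (k x)) x \<le> m (E j) x)" by metis
    \<comment> \<open>The stages of stabilisation, at most \<open>|\<tau>|\<close> many, are bounded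
      below \<open>\<tau>' = nextc \<tau>\<close>. After that bound a point of
      \<open>G (E i) a\<close> is also rounded down into a later \<open>E j\<close>, which is
      contained in \<open>N (E i)\<close>.\<close>
    have "\<exists>i\<in>{..<\<tau>'}. \<forall>x\<in>L a. k x < i"
      using k bounding_nextc[OF t(1,2)] L[OF a(1)] unfolding \<tau>'_def[symmetric]
      by (intro bounding_image) auto
    then obtain i where i: "i < \<tau>'" "\<forall>x\<in>L a. k x < i" by auto
    obtain j where j: "i < j" "j < \<tau>'"
      using succ_like_above[OF succ_like_nextc[OF t(1,2)], of i "\<lambda>x. x"] i unfolding \<tau>'_def by auto
    have "G (E i) a \<subseteq> N (E i)"
    proof
      fix y assume "y \<in> G (E i) a"
      then obtain x z where x: "x \<in> L a" "y = m (E i) x" "z < y" unfolding G_def by auto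
      have "m (E i) x = m (E j) x"
      proof (rule antisym)
        have "m (E i) x \<le> m (E (k x)) x" using i(2) x(1) by (intro mono) (simp add: less_imp_le)
        also have "\<dots> \<le> m (E j) x" using k j(2) by blast
        finally show "m (E i) x \<le> m (E j) x" .
      qed (use mono j in \<open>simp add: less_imp_le\<close>)
      then have y: "y = m (E j) x" using x by simp
      have "x \<in> D" using x(1) L[OF a(1)] Dseg[of a] a(1) unfolding P_def by auto
      then have "y \<in> E j"
        using x(3) osup_segment_in_club[OF Ecl[OF j(2)] Dseg, of x z] unfolding y m_def by auto
      then show "y \<in> N (E i)" using j(1) E[of j] by auto
    qed
    then show False using N[OF Ecl[OF i(1)]] a(1) lim[OF i(1)] by blast
  qed
  then obtain E where E: "club_in D E" "\<And>E'. club_in D E' \<Longrightarrow> \<exists>a. P a \<and> lim E a \<and> G E a \<subseteq> E'"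
    by blast
  define \<C> where "\<C> = G E ` {a \<in> D. P a \<and> lim E a}"
  have "|\<C>| \<le>o |{..<\<kappa>}|"
    unfolding \<C>_def D_def by (intro card_le_image card_of_mono1) auto
  moreover have "c \<subseteq> {..<\<kappa>} \<and> bounding v c" if "c \<in> \<C>" for c
    using that G_bd unfolding \<C>_def D_def by blast
  moreover have "\<exists>c\<in>\<C>. c \<subseteq> E'" if "club_in {..<\<kappa>} E'" for E'
    using E(2)[of E'] that unfolding \<C>_def D_def P_def by blast
  ultimately show ?thesis by blast
qed

end

section \<open>A scale of length \<open>\<mu>\<^sup>+\<close>\<close>

definition limit_closure :: "'a::wellorder \<Rightarrow> 'a set \<Rightarrow> 'a set" where
  "limit_closure \<gamma> X = {y. y < \<gamma> \<and> (y \<in> X \<or> (\<exists>z. z < y) \<and> (\<forall>z<y. \<exists>x\<in>X. z < x \<and> x < y))}"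

lemma limit_closure_mono: "X \<subseteq> Y \<Longrightarrow> limit_closure \<gamma> X \<subseteq> limit_closure \<gamma> Y"
  unfolding limit_closure_def by blast

text \<open>Sending a limit point to the least element of \<open>X\<close> above it is injective,
  because \<open>X\<close> has elements strictly between two limit points. At most one limit point
  lies above all of \<open>X\<close>.\<close>

lemma card_limit_closure:
  fixes X :: "'a::wellorder set"
  assumes "infinite B" "|X| \<le>o |B|"
  shows "|limit_closure \<gamma> X| \<le>o |B|"
proof -
  define L where "L = {y. (\<exists>z. z < y) \<and> (\<forall>z<y. \<exists>x\<in>X. z < x \<and> x < y)}"
  define L1 where "L1 = {y \<in> L. \<exists>x\<in>X. y \<le> x}"
  define F where "F y = (LEAST x. x \<in> X \<and> y \<le> x)" for y
  have F: "F y \<in> X \<and> y \<le> F y" if "y \<in> L1" for y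
  proof -
    have "\<exists>x. x \<in> X \<and> y \<le> x" using that by (auto simp: L1_def)
    then show ?thesis unfolding F_def by (rule LeastI_ex)
  qed
  have lt: "F y < F y'" if y: "y \<in> L1" "y' \<in> L1" "y < y'" for y y'
  proof -
    obtain x where x: "x \<in> X" "y < x" "x < y'" using y unfolding L1_def L_def by blast
    have "F y \<le> x" unfolding F_def using x by (intro Least_le) auto
    also have "x < y'" by (rule x)
    also have "y' \<le> F y'" using F[OF y(2)] by simp
    finally show ?thesis .
  qed
  have "inj_on F L1"
    by (rule linorder_inj_onI') (use lt in force)
  moreover have "F ` L1 \<subseteq> X" using F by auto
  ultimately have "|L1| \<le>o |X|" by (rule card_leI)
  then have 1: "|L1| \<le>o |B|" using assms(2) card_le_trans by blast
  have no: "\<not> y < y'" if "y \<in> L - L1" "y' \<in> L - L1" for y y'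
  proof
    assume "y < y'"
    then obtain x where "x \<in> X" "y < x" using \<open>y' \<in> L - L1\<close> unfolding L_def by blast
    then show False using \<open>y \<in> L - L1\<close> less_imp_le[of y x] unfolding L1_def by blast
  qed
  have "y = y'" if "y \<in> L - L1" "y' \<in> L - L1" for y y'
    using no that by (metis linorder_neqE)
  then have "finite (L - L1)" by (metis finite.simps is_singletonI' is_singleton_def)
  then have "|L - L1| \<le>o |B|" using assms(1) card_le_finite by blast
  then have "|X \<union> (L1 \<union> (L - L1))| \<le>o |B|" using assms 1 by (intro card_le_Un) auto
  moreover have "limit_closure \<gamma> X \<subseteq> X \<union> (L1 \<union> (L - L1))" by (auto simp: limit_closure_def L_def)
  ultimately show ?thesis using card_le_subset by blast
qed

context singular_successor
begin

section \<open>A sequence of functions on \<theta>, increasing modulo bounded sets\<close>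

definition nu :: "'a \<Rightarrow> 'a" where
  "nu = (SOME \<nu>. (\<forall>i<\<theta>. \<nu> i < \<mu> \<and> \<theta> \<le> \<nu> i) \<and> (\<forall>x<\<mu>. \<exists>i<\<theta>. x < \<nu> i) \<and> (\<forall>i j. i \<le> j \<longrightarrow> j < \<theta> \<longrightarrow> \<nu> i \<le> \<nu> j))"

lemma nu_props: "(\<forall>i<\<theta>. nu i < \<mu> \<and> \<theta> \<le> nu i) \<and> (\<forall>x<\<mu>. \<exists>i<\<theta>. x < nu i) \<and> (\<forall>i j. i \<le> j \<longrightarrow> j < \<theta> \<longrightarrow> nu i \<le> nu j)"
  unfolding nu_def by (rule someI_ex[OF exists_cofinal_mono])

lemma nu_less: "i < \<theta> \<Longrightarrow> nu i < \<mu>" and nu_ge: "i < \<theta> \<Longrightarrow> \<theta> \<le> nu i"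
  and nu_cofinal: "x < \<mu> \<Longrightarrow> \<exists>i<\<theta>. x < nu i" and nu_mono: "i \<le> j \<Longrightarrow> j < \<theta> \<Longrightarrow> nu i \<le> nu j"
  using nu_props by simp_all

lemma nu_infinite: "i < \<theta> \<Longrightarrow> infinite {..<nu i}"
  using infinite_mono[OF nu_ge infinite_cf] .

definition enum_below :: "'a \<Rightarrow> 'a \<Rightarrow> 'a" where
  "enum_below \<gamma> = (SOME g. inj_on g {..<\<gamma>} \<and> g ` {..<\<gamma>} \<subseteq> {..<\<mu>})"

lemma enum_below: "inj_on (enum_below \<gamma>) {..<\<gamma>} \<and> enum_below \<gamma> ` {..<\<gamma>} \<subseteq> {..<\<mu>}"
  unfolding enum_below_def by (rule someI_ex[OF iffD2[OF card_of_ordLeq card_segment_le]])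

definition piece :: "'a \<Rightarrow> 'a \<Rightarrow> 'a set" where
  "piece \<gamma> j = {x. x < \<gamma> \<and> enum_below \<gamma> x < nu j}"

lemma piece_below: "piece \<gamma> j \<subseteq> {..<\<gamma>}" by (auto simp: piece_def)

lemma piece_mono: "i \<le> j \<Longrightarrow> j < \<theta> \<Longrightarrow> piece \<gamma> i \<subseteq> piece \<gamma> j"
  using nu_mono by (fastforce simp: piece_def)

lemma piece_cover: "x < \<gamma> \<Longrightarrow> \<exists>j<\<theta>. x \<in> piece \<gamma> j"
  using enum_below[of \<gamma>] nu_cofinal[of "enum_below \<gamma> x"] by (auto simp: piece_def)

lemma card_piece: "|piece \<gamma> j| \<le>o |{..<nu j}|"
proof -
  have "inj_on (enum_below \<gamma>) (piece \<gamma> j)"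
    using enum_below[of \<gamma>] piece_below[of \<gamma> j] inj_on_subset by metis
  moreover have "enum_below \<gamma> ` piece \<gamma> j \<subseteq> {..<nu j}" by (auto simp: piece_def)
  ultimately show ?thesis by (rule card_leI)
qed

text \<open>Limits are added so that suprema of points from one piece are caught with the same index
  \<open>j\<close>; \<open>bounding_projection\<close> depends on this uniformity.\<close>

definition cpiece :: "'a \<Rightarrow> 'a \<Rightarrow> 'a set" where
  "cpiece \<gamma> j = limit_closure \<gamma> (piece \<gamma> j)"

lemma cpiece_below: "x \<in> cpiece \<gamma> j \<Longrightarrow> x < \<gamma>"
  by (auto simp: cpiece_def limit_closure_def)

lemma cpiece_mono: "i \<le> j \<Longrightarrow> j < \<theta> \<Longrightarrow> cpiece \<gamma> i \<subseteq> cpiece \<gamma> j"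
  unfolding cpiece_def by (intro limit_closure_mono piece_mono)

lemma piece_subset_cpiece: "piece \<gamma> j \<subseteq> cpiece \<gamma> j"
  by (auto simp: cpiece_def limit_closure_def piece_def)

lemma card_cpiece: "j < \<theta> \<Longrightarrow> |cpiece \<gamma> j| \<le>o |{..<nu j}|"
  unfolding cpiece_def by (intro card_limit_closure nu_infinite card_piece)

text \<open>For each \<open>j\<close>, the rank of \<gamma> in the well-founded relation
  \<open>x \<in> cpiece \<gamma> j\<close>. Every \<open>x < \<gamma>\<close> is in this relation to
  \<gamma> for all large \<open>j\<close>, whence the growth modulo bounded sets.\<close>

definition incr :: "'a \<Rightarrow> 'a \<Rightarrow> 'a" where
  "incr = (SOME f. \<forall>\<gamma> j. f \<gamma> j = ssup ((\<lambda>x. f x j) ` cpiece \<gamma> j))"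

lemma incr_eq: "incr \<gamma> j = ssup ((\<lambda>x. incr x j) ` cpiece \<gamma> j)"
proof -
  define H where "H f \<gamma> j = ssup ((\<lambda>x. f x j) ` cpiece \<gamma> j)" for f :: "'a \<Rightarrow> 'a \<Rightarrow> 'a" and \<gamma> j
  obtain f where f: "\<forall>\<gamma>. f \<gamma> = H (\<lambda>x. if x < \<gamma> then f x else undefined) \<gamma>"
    using wellorder_recursion[of H] by (rule exE)
  have "H (\<lambda>x. if x < \<gamma> then f x else undefined) \<gamma> j = ssup ((\<lambda>x. f x j) ` cpiece \<gamma> j)" for \<gamma> j
    unfolding H_def by (rule arg_cong[where f = ssup], rule image_cong) (auto dest: cpiece_below)
  then have "\<forall>\<gamma> j. f \<gamma> j = ssup ((\<lambda>x. f x j) ` cpiece \<gamma> j)" using f by metis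
  then have "\<exists>f :: 'a \<Rightarrow> 'a \<Rightarrow> 'a. \<forall>\<gamma> j. f \<gamma> j = ssup ((\<lambda>x. f x j) ` cpiece \<gamma> j)" by blast
  then have "\<forall>\<gamma> j. incr \<gamma> j = ssup ((\<lambda>x. incr x j) ` cpiece \<gamma> j)"
    unfolding incr_def by (rule someI_ex)
  then show ?thesis by blast
qed

lemma incr_bound: "j < \<theta> \<Longrightarrow> incr \<gamma> j < nextc (nu j)"
proof (induction \<gamma> rule: less_induct)
  case (less \<gamma>)
  have "\<exists>c\<in>{..<nextc (nu j)}. \<forall>x\<in>cpiece \<gamma> j. incr x j < c"
    using less cpiece_below
    by (intro bounding_image[OF bounding_nextc card_cpiece] nu_less nu_infinite) auto
  then obtain c where "c < nextc (nu j)" "\<forall>x\<in>cpiece \<gamma> j. incr x j < c" by auto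
  moreover from this have "incr \<gamma> j \<le> c" unfolding incr_eq[of \<gamma>] by (intro ssup_le) auto
  ultimately show ?case by simp
qed

lemma incr_less:
  assumes "x \<in> cpiece \<gamma> j" "j < \<theta>"
  shows "incr x j < incr \<gamma> j"
  unfolding incr_eq[of \<gamma>] using assms incr_bound by (intro ssup_upper[of _ "nextc (nu j)"]) auto

definition tail_le :: "('a \<Rightarrow> 'a) \<Rightarrow> ('a \<Rightarrow> 'a) \<Rightarrow> bool" where
  "tail_le g h \<longleftrightarrow> (\<exists>j0<\<theta>. \<forall>j. j0 \<le> j \<longrightarrow> j < \<theta> \<longrightarrow> g j \<le> h j)"

definition tail_less :: "('a \<Rightarrow> 'a) \<Rightarrow> ('a \<Rightarrow> 'a) \<Rightarrow> bool" where
  "tail_less g h \<longleftrightarrow> (\<exists>j0<\<theta>. \<forall>j. j0 \<le> j \<longrightarrow> j < \<theta> \<longrightarrow> g j < h j)"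

lemma tail_conj:
  assumes "\<exists>j0<\<theta>. \<forall>j. j0 \<le> j \<longrightarrow> j < \<theta> \<longrightarrow> P j" "\<exists>j0<\<theta>. \<forall>j. j0 \<le> j \<longrightarrow> j < \<theta> \<longrightarrow> Q j"
  shows "\<exists>j0<\<theta>. \<forall>j. j0 \<le> j \<longrightarrow> j < \<theta> \<longrightarrow> P j \<and> Q j"
proof -
  obtain a b where "a < \<theta>" "b < \<theta>" "\<forall>j. a \<le> j \<longrightarrow> j < \<theta> \<longrightarrow> P j" "\<forall>j. b \<le> j \<longrightarrow> j < \<theta> \<longrightarrow> Q j"
    using assms by blast
  then show ?thesis by (intro exI[of _ "max a b"]) auto
qed

lemma tail_le_trans: "tail_le g h \<Longrightarrow> tail_le h k \<Longrightarrow> tail_le g k"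
  unfolding tail_le_def by (drule (1) tail_conj) (meson order_trans)

lemma tail_less_le_trans: "tail_less g h \<Longrightarrow> tail_le h k \<Longrightarrow> tail_less g k"
  unfolding tail_le_def tail_less_def by (drule (1) tail_conj) (meson less_le_trans)

lemma tail_less_imp_le: "tail_less g h \<Longrightarrow> tail_le g h"
  unfolding tail_le_def tail_less_def using less_imp_le by meson

lemma tail_le_min: "tail_le g h \<Longrightarrow> tail_le g k \<Longrightarrow> tail_le g (\<lambda>j. min (h j) (k j))"
  unfolding tail_le_def by (drule (1) tail_conj) auto

lemma incr_strict:
  assumes "x < \<gamma>"
  shows "tail_less (incr x) (incr \<gamma>)"
proof -
  obtain i where i: "i < \<theta>" "x \<in> piece \<gamma> i" using piece_cover[OF assms] by auto
  then have "x \<in> cpiece \<gamma> j" if "i \<le> j" "j < \<theta>" for j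
    using that piece_subset_cpiece cpiece_mono by blast
  then show ?thesis unfolding tail_less_def using i incr_less by blast
qed

lemma incr_mono: "x \<le> \<gamma> \<Longrightarrow> tail_le (incr x) (incr \<gamma>)"
proof (cases "x = \<gamma>")
  case True
  obtain z where "z < \<theta>" using nu_cofinal[OF cf_mu] by blast
  then show ?thesis using True by (auto simp: tail_le_def)
qed (simp add: incr_strict tail_less_imp_le)

text \<open>One tail has to serve all of \<open>X\<close>, which is stronger than
  \<open>tail_le\<close> for each element.\<close>

definition upb :: "'a \<Rightarrow> 'a set \<Rightarrow> bool" where
  "upb \<beta> X \<longleftrightarrow> (\<exists>j0<\<theta>. \<forall>j. j0 \<le> j \<longrightarrow> j < \<theta> \<longrightarrow> (\<forall>x\<in>X. incr x j \<le> incr \<beta> j))"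

lemma upb_mono:
  assumes "upb \<beta> X" "\<beta> \<le> \<beta>'"
  shows "upb \<beta>' X"
  using tail_conj[OF assms(1)[unfolded upb_def] incr_mono[OF assms(2), unfolded tail_le_def]]
  unfolding upb_def by (meson order_trans)

text \<open>Rounding up into small sets. It is meaningful only where \<open>S j\<close> reaches
  \<open>incr \<gamma> j\<close>; in the applications the element \<open>nextc (nu j)\<close> of
  \<open>S j\<close> ensures this.\<close>

definition proj :: "('a \<Rightarrow> 'a set) \<Rightarrow> 'a \<Rightarrow> 'a \<Rightarrow> 'a" where
  "proj S \<gamma> j = (LEAST s. s \<in> S j \<and> incr \<gamma> j \<le> s)"

lemma proj_le: "s \<in> S j \<Longrightarrow> incr \<gamma> j \<le> s \<Longrightarrow> proj S \<gamma> j \<le> s"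
  unfolding proj_def by (rule Least_le) simp

lemma proj_props:
  assumes "\<exists>s\<in>S j. incr \<gamma> j \<le> s"
  shows "proj S \<gamma> j \<in> S j" "incr \<gamma> j \<le> proj S \<gamma> j"
proof -
  have "\<exists>s. s \<in> S j \<and> incr \<gamma> j \<le> s" using assms by auto
  then have "proj S \<gamma> j \<in> S j \<and> incr \<gamma> j \<le> proj S \<gamma> j"
    unfolding proj_def by (rule LeastI_ex)
  then show "proj S \<gamma> j \<in> S j" "incr \<gamma> j \<le> proj S \<gamma> j" by auto
qed

text \<open>Were the claim false, an increasing chain \<open>\<xi>\<close> of length \<open>\<kappa>\<close> could be built along which the projections
  keep growing modulo bounded sets. Club guessing yields \<open>c\<close> along which the suprema \<open>\<xi>' k\<close> are uniformly
  bounded below the next members of the chain; as \<open>S j\<close> is smaller than the cofinality of \<open>c\<close>,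
  the projections along \<open>c\<close> stabilise, which is absurd.\<close>

lemma bounding_projection:
  assumes v: "v < \<mu>" "\<theta> \<le> v"
    and S: "\<And>j. j < \<theta> \<Longrightarrow> |S j| \<le>o |{..<v}|"
    and ex: "\<And>j \<gamma>. j < \<theta> \<Longrightarrow> \<exists>s\<in>S j. incr \<gamma> j \<le> s"
  shows "\<exists>\<gamma>. \<forall>\<gamma>'. tail_le (incr \<gamma>') (proj S \<gamma>)"
proof (rule ccontr)
  assume "\<not> ?thesis"
  then obtain nx where nx: "\<And>\<gamma>. \<not> tail_le (incr (nx \<gamma>)) (proj S \<gamma>)" by metis
  have nx': "\<not> tail_le (incr \<gamma>') (proj S \<gamma>)" if "nx \<gamma> \<le> \<gamma>'" for \<gamma> \<gamma>'
    using nx[of \<gamma>] tail_le_trans[OF incr_mono[OF that]] by blast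
  have vinf: "infinite {..<v}" using infinite_mono[OF v(2) infinite_cf] .
  define \<tau> where "\<tau> = nextc (nextc v)"
  define \<kappa> where "\<kappa> = nextc \<tau>"
  have t: "\<tau> < \<mu>" "infinite {..<\<tau>}" "v < \<tau>"
    unfolding \<tau>_def using v vinf nextc_gt[of v] nextc_gt[of "nextc v"]
    by (auto simp: nextc_less infinite_nextc)
  have k: "\<kappa> < \<mu>" unfolding \<kappa>_def using t nextc_less by blast
  have D: "succ_like \<tau> {..<\<kappa>}" unfolding \<kappa>_def by (rule succ_like_nextc[OF t(1,2)])
  obtain \<C> where \<C>: "|\<C>| \<le>o |{..<\<kappa>}|" "\<And>c. c \<in> \<C> \<Longrightarrow> c \<subseteq> {..<\<kappa>} \<and> bounding v c"
    "\<And>E. club_in {..<\<kappa>} E \<Longrightarrow> \<exists>c\<in>\<C>. c \<subseteq> E"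
    using club_guessing[OF v(1) vinf] unfolding \<kappa>_def \<tau>_def by blast
  \<comment> \<open>For \<open>k \<le> i\<close> only values of \<xi> below \<open>i\<close> enter,
    so the set may be used when \<open>\<xi> i\<close> is chosen.\<close>
  define Y where "Y \<xi> c i = (\<lambda>k. ssup (\<xi> ` {..<k})) ` {k \<in> c. k \<le> i}" for \<xi> :: "'a \<Rightarrow> 'a" and c i
  \<comment> \<open>Whenever some ordinal bounds such a set uniformly, the next member of the chain
    is required to do so. Only \<open>|\<C>| \<le> |\<kappa>|\<close> sets compete, so all demands
    can be met at once.\<close>
  define good where "good \<xi> i x \<longleftrightarrow> (\<forall>i'<i. nx (\<xi> i') < x \<and> \<xi> i' < x) \<and>
    (\<forall>c\<in>\<C>. (\<exists>\<beta>. upb \<beta> (Y \<xi> c i)) \<longrightarrow> upb x (Y \<xi> c i))" for \<xi> i x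
  define H where "H \<xi> i = (SOME x. good \<xi> i x)" for \<xi> i
  obtain \<xi> where \<xi>0: "\<forall>i. \<xi> i = H (\<lambda>j. if j < i then \<xi> j else undefined) i"
    using wellorder_recursion[of H] by (rule exE)
  have Y_cut: "Y (\<lambda>j. if j < i then \<xi> j else undefined) c i = Y \<xi> c i" for c i
    unfolding Y_def by (intro image_cong refl arg_cong[where f = ssup]) auto
  have good_cut: "good (\<lambda>j. if j < i then \<xi> j else undefined) i = good \<xi> i" for i
    by (rule ext) (simp add: good_def Y_cut)
  have good: "good \<xi> i (\<xi> i)" for i
  proof -
    define B where "B c = (SOME \<beta>. upb \<beta> (Y \<xi> c i))" for c
    have B: "upb (B c) (Y \<xi> c i)" if "\<exists>\<beta>. upb \<beta> (Y \<xi> c i)" for c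
      unfolding B_def using that by (rule someI_ex)
    have "|\<C>| \<le>o |{..<\<mu>}|"
      using \<C>(1) card_lessThan_mono[of \<kappa> \<mu>] k card_le_trans less_imp_le by blast
    then have "|((nx \<circ> \<xi>) ` {..<i} \<union> \<xi> ` {..<i}) \<union> B ` \<C>| \<le>o |{..<\<mu>}|"
      using card_segment_le infinite_mu by (intro card_le_Un card_le_image)
    then obtain x where x: "\<forall>y\<in>((nx \<circ> \<xi>) ` {..<i} \<union> \<xi> ` {..<i}) \<union> B ` \<C>. y < x"
      using boundingD[OF bounding_UNIV] by blast
    have "upb x (Y \<xi> c i)" if "c \<in> \<C>" "\<exists>\<beta>. upb \<beta> (Y \<xi> c i)" for c
      using upb_mono[OF B[OF that(2)]] x that(1) by (simp add: less_imp_le)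
    then have "good \<xi> i x" using x unfolding good_def by auto
    then show ?thesis
      using \<xi>0[rule_format, of i] good_cut[of i] someI[of "good \<xi> i" x] unfolding H_def by metis
  qed
  define \<xi>' where "\<xi>' k = ssup (\<xi> ` {..<k})" for k
  have \<xi>_nx: "nx (\<xi> i) < \<xi> j" and \<xi>_mono: "\<xi> i < \<xi> j" if "i < j" for i j
    using good[of j] that by (auto simp: good_def)
  have \<xi>_upb: "upb (\<xi> i) (\<xi>' ` {k \<in> c. k \<le> i})" if "c \<in> \<C>" "upb \<beta> (\<xi>' ` {k \<in> c. k \<le> i})" for i c \<beta>
    using good[of i] that unfolding good_def Y_def \<xi>'_def by blast
  have \<xi>'_up: "\<xi> i < \<xi>' k" if "i < k" for i k
    unfolding \<xi>'_def using that \<xi>_mono by (intro ssup_upper[of _ "\<xi> k"]) auto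
  obtain \<beta> where \<beta>: "\<And>i. i < \<kappa> \<Longrightarrow> \<xi> i < \<beta>"
    using bounding_image[OF bounding_UNIV card_segment_le[of \<kappa>], of \<xi>] by auto
  \<comment> \<open>Pigeonhole: the \<theta> pieces of \<beta> cover a chain of length \<kappa>,
    whose cofinality exceeds \<theta>, so one piece contains cofinally many members.\<close>
  have "\<exists>j<\<theta>. \<forall>b<\<kappa>. \<exists>i<\<kappa>. b < i \<and> \<xi> i \<in> piece \<beta> j"
  proof (rule ccontr)
    assume "\<not> ?thesis"
    then obtain b where b: "\<And>j. j < \<theta> \<Longrightarrow> b j < \<kappa> \<and> (\<forall>i<\<kappa>. \<xi> i \<in> piece \<beta> j \<longrightarrow> \<not> b j < i)" by metis
    have "|{..<\<theta>}| \<le>o |{..<\<tau>}|" using v t by (intro card_lessThan_mono) simp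
    moreover have "b ` {..<\<theta>} \<subseteq> {..<\<kappa>}" using b by auto
    ultimately have "\<exists>i\<in>{..<\<kappa>}. \<forall>j\<in>{..<\<theta>}. b j < i"
      using D by (intro bounding_image[of \<tau>]) (auto simp: succ_like_def)
    then obtain i where i: "i < \<kappa>" "\<forall>j<\<theta>. b j < i" by auto
    obtain j where "j < \<theta>" "\<xi> i \<in> piece \<beta> j" using piece_cover[OF \<beta>[OF i(1)]] by auto
    then show False using b i by blast
  qed
  then obtain j where j: "j < \<theta>" "\<forall>b<\<kappa>. \<exists>i<\<kappa>. b < i \<and> \<xi> i \<in> piece \<beta> j" by blast
  then obtain g where g: "\<And>b. b < \<kappa> \<Longrightarrow> g b < \<kappa> \<and> b < g b \<and> \<xi> (g b) \<in> piece \<beta> j" by metis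
  have "club_in {..<\<kappa>} (closure_points g {..<\<kappa>})"
    using g by (intro closure_points_club[OF D]) auto
  then obtain c where c: "c \<in> \<C>" "c \<subseteq> closure_points g {..<\<kappa>}" using \<C>(3) by blast
  have in_cpiece: "\<xi>' k \<in> cpiece \<beta> j" if "k \<in> c" for k
  proof -
    have k: "k < \<kappa>" "\<exists>x. x < k" "\<forall>x<k. \<exists>y<k. x < y \<and> g x < y"
      using c(2) that by (auto simp: closure_points_def)
    have "\<xi>' k \<le> \<xi> k" unfolding \<xi>'_def using \<xi>_mono by (intro ssup_le) auto
    then have "\<xi>' k < \<beta>" using \<beta>[OF k(1)] by simp
    moreover have "\<exists>z. z < \<xi>' k" using k(2) \<xi>'_up by blast
    moreover have "\<exists>x\<in>piece \<beta> j. z < x \<and> x < \<xi>' k" if z: "z < \<xi>' k" for z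
    proof -
      obtain i where i: "i < k" "z \<le> \<xi> i" using less_ssup[of z "\<xi> ` {..<k}"] z unfolding \<xi>'_def by auto
      have "g i < k" using k(3) i(1) by (meson less_trans)
      then have "\<xi> (g i) < \<xi>' k" by (rule \<xi>'_up)
      moreover have "\<xi> i < \<xi> (g i)" "\<xi> (g i) \<in> piece \<beta> j" using g[of i] i k(1) \<xi>_mono by auto
      ultimately show ?thesis using i(2) by (intro bexI[of _ "\<xi> (g i)"]) auto
    qed
    ultimately show ?thesis by (auto simp: cpiece_def limit_closure_def)
  qed
  have "upb \<beta> (\<xi>' ` {k \<in> c. k \<le> i})" for i
    unfolding upb_def
  proof (intro exI[of _ j] conjI allI impI ballI)
    fix j' x assume "j \<le> j'" "j' < \<theta>" "x \<in> \<xi>' ` {k \<in> c. k \<le> i}"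
    then have "x \<in> cpiece \<beta> j'" using in_cpiece cpiece_mono by blast
    then show "incr x j' \<le> incr \<beta> j'" using incr_less \<open>j' < \<theta>\<close> by (simp add: less_imp_le)
  qed (rule j(1))
  then have up: "upb (\<xi> i) (\<xi>' ` {k \<in> c. k \<le> i})" for i using \<xi>_upb[OF c(1)] by blast
  \<comment> \<open>One representative in \<open>c\<close> for each coordinate and each value of the
    projection. There are at most \<open>|v|\<close> of them, so some \<open>k \<in> c\<close> lies
    above all.\<close>
  define w where "w j s = (SOME x. x \<in> c \<and> proj S (\<xi>' x) j = s)" for j s
  have w: "w j (proj S (\<xi>' x) j) \<in> c \<and> proj S (\<xi>' (w j (proj S (\<xi>' x) j))) j = proj S (\<xi>' x) j"
    if "x \<in> c" for x j
    unfolding w_def by (rule someI[of _ x]) (simp add: that)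
  define W where "W = c \<inter> (\<Union>j\<in>{..<\<theta>}. w j ` S j)"
  have "|\<Union>j\<in>{..<\<theta>}. w j ` S j| \<le>o |{..<v}|"
    using S by (intro card_le_UN[OF vinf] card_lessThan_mono[OF v(2)] card_le_image) auto
  then have "|W| \<le>o |{..<v}|" unfolding W_def by (rule card_le_subset[rotated]) auto
  then have "\<exists>k\<in>c. \<forall>x\<in>W. x < k"
    using \<C>(2)[OF c(1)] by (intro boundingD[of v]) (auto simp: W_def)
  then obtain k where k: "k \<in> c" "\<forall>x\<in>W. x < k" by blast
  have "|{k}| \<le>o |{..<v}|" using vinf by (intro card_le_finite) auto
  then have "\<exists>x\<in>c. \<forall>y\<in>{k}. y < x"
    using \<C>(2)[OF c(1)] k(1) by (intro boundingD[of v]) auto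
  then obtain x where x: "x \<in> c" "k < x" by auto
  then obtain y where "y < x" "k < y" using c(2) by (auto simp: closure_points_def)
  then have "nx (\<xi> k) \<le> \<xi>' x" using \<xi>_nx[of k y] \<xi>'_up[of y x] by simp
  then have "\<not> tail_le (incr (\<xi>' x)) (proj S (\<xi> k))" by (rule nx')
  moreover have "tail_le (incr (\<xi>' x)) (proj S (\<xi> k))"
  proof -
    obtain j1 where j1: "j1 < \<theta>" "\<And>j z. j1 \<le> j \<Longrightarrow> j < \<theta> \<Longrightarrow> z \<in> c \<Longrightarrow> z \<le> k \<Longrightarrow> incr (\<xi>' z) j \<le> incr (\<xi> k) j"
      using up[of k] unfolding upb_def by auto
    \<comment> \<open>The representative with the same projection as \<open>x\<close> lies below
      \<open>k\<close>, so \<open>\<xi> k\<close> dominates it on the common tail; rounding up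
      transfers this to the value \<open>s\<close>.\<close>
    have "incr (\<xi>' x) j \<le> proj S (\<xi> k) j" if j: "j1 \<le> j" "j < \<theta>" for j
    proof -
      define s where "s = proj S (\<xi>' x) j"
      have s: "s \<in> S j" "incr (\<xi>' x) j \<le> s" unfolding s_def using proj_props[where S = S, OF ex[OF j(2)]] by auto
      have ws: "w j s \<in> c" "proj S (\<xi>' (w j s)) j = s" unfolding s_def using w[OF x(1)] by auto
      then have "w j s \<in> W" using s(1) j(2) by (auto simp: W_def)
      then have "incr (\<xi>' (w j s)) j \<le> incr (\<xi> k) j" using j1(2)[OF j ws(1)] k(2) by (simp add: less_imp_le)
      then have "proj S (\<xi>' (w j s)) j \<le> proj S (\<xi> k) j"
        using proj_props[where S = S, OF ex[OF j(2)], of "\<xi> k"] by (intro proj_le) auto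
      then show ?thesis using s(2) unfolding ws(2) by simp
    qed
    then show ?thesis using j1(1) unfolding tail_le_def by blast
  qed
  ultimately show False by blast
qed

section \<open>The least upper bound of the sequence, its exactness and its cofinalities\<close>

definition bound :: "('a \<Rightarrow> 'a) \<Rightarrow> bool" where
  "bound h \<longleftrightarrow> (\<forall>\<gamma>. tail_le (incr \<gamma>) h)"

text \<open>Lower a bound repeatedly, \<open>nextc \<theta>\<close> times, each time after rounding
  up into the values obtained so far. The roundings stabilise in all \<theta> coordinates at once,
  and then one more lowering would be no lowering on a tail.\<close>

lemma least_upper_bound:
  shows "\<exists>g. bound g \<and> (\<forall>j<\<theta>. g j \<le> nextc (nu j)) \<and>
    (\<forall>h. bound h \<longrightarrow> (\<forall>j<\<theta>. h j \<le> g j) \<longrightarrow> tail_le g h)"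
proof (rule ccontr)
  assume "\<not> ?thesis"
  then obtain N where N: "\<And>g. bound g \<Longrightarrow> (\<forall>j<\<theta>. g j \<le> nextc (nu j)) \<Longrightarrow>
      bound (N g) \<and> (\<forall>j<\<theta>. N g j \<le> g j) \<and> \<not> tail_le g (N g)"
    by metis
  \<comment> \<open>For \<open>\<alpha> < nextc \<theta>\<close> these sets have size at most
    \<open>|\<theta>|\<close>, so \<open>bounding_projection\<close> applies with
    \<open>v = \<theta>\<close>.\<close>
  define SS where "SS g \<alpha> j = insert (nextc (nu j)) ((\<lambda>\<beta>. g \<beta> j) ` {..<\<alpha>})" for g :: "'a \<Rightarrow> 'a \<Rightarrow> 'a" and \<alpha> j
  define W where "W S = (SOME \<gamma>. \<forall>\<gamma>'. tail_le (incr \<gamma>') (proj S \<gamma>))" for S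
  define H where "H g \<alpha> = N (proj (SS g \<alpha>) (W (SS g \<alpha>)))" for g \<alpha>
  obtain g where g0: "\<forall>\<alpha>. g \<alpha> = H (\<lambda>j. if j < \<alpha> then g j else undefined) \<alpha>"
    using wellorder_recursion[of H] by (rule exE)
  have "SS (\<lambda>j. if j < \<alpha> then g j else undefined) \<alpha> = SS g \<alpha>" for \<alpha>
    unfolding SS_def by (rule ext) auto
  then have g: "g \<alpha> = N (proj (SS g \<alpha>) (W (SS g \<alpha>)))" for \<alpha>
    using g0[rule_format, of \<alpha>] unfolding H_def by simp
  define \<rho> where "\<rho> = nextc \<theta>"
  have \<rho>: "bounding \<theta> {..<\<rho>}" unfolding \<rho>_def by (rule bounding_nextc[OF cf_mu infinite_cf])
  define w where "w \<alpha> = W (SS g \<alpha>)" for \<alpha>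
  have ex: "\<exists>s\<in>SS g \<alpha> j. incr \<gamma> j \<le> s" if "j < \<theta>" for \<alpha> j \<gamma>
    using incr_bound[OF that, of \<gamma>] by (auto simp: SS_def)
  have w: "bound (proj (SS g \<alpha>) (w \<alpha>))" if "\<alpha> < \<rho>" for \<alpha>
  proof -
    have "|SS g \<alpha> j| \<le>o |{..<\<theta>}|" for j
      unfolding SS_def using less_nextc[of \<alpha> \<theta>] that infinite_cf unfolding \<rho>_def
      by (intro card_le_insert card_le_image)
    then have "\<exists>\<gamma>. \<forall>\<gamma>'. tail_le (incr \<gamma>') (proj (SS g \<alpha>) \<gamma>)"
      using bounding_projection[OF cf_mu order_refl] ex by blast
    then show ?thesis unfolding bound_def w_def W_def by (rule someI_ex)
  qed
  have proj_top: "proj (SS g \<alpha>) \<gamma> j \<le> nextc (nu j)" if "j < \<theta>" for \<alpha> \<gamma> j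
    using incr_bound[OF that, of \<gamma>] by (intro proj_le) (auto simp: SS_def)
  have gN: "bound (g \<alpha>) \<and> \<not> tail_le (proj (SS g \<alpha>) (w \<alpha>)) (g \<alpha>)" if "\<alpha> < \<rho>" for \<alpha>
    using N[OF w[OF that]] proj_top g[of \<alpha>] unfolding w_def by auto
  \<comment> \<open>Rounding one common function \<open>incr \<xi>\<close> makes the stages
    comparable: \<open>Q \<alpha> j\<close> decreases with \<alpha> for every
    \<open>j\<close>.\<close>
  obtain \<xi> where \<xi>: "\<forall>\<alpha>\<in>{..<\<rho>}. w \<alpha> < \<xi>"
    using bounding_image[OF bounding_UNIV card_segment_le, of w] by auto
  define Q where "Q \<alpha> = proj (SS g \<alpha>) \<xi>" for \<alpha>
  have Q_anti: "Q \<beta> j \<le> Q \<alpha> j" if "\<alpha> \<le> \<beta>" "j < \<theta>" for \<alpha> \<beta> j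
  proof -
    have "SS g \<alpha> j \<subseteq> SS g \<beta> j" using that(1) by (auto simp: SS_def)
    then show ?thesis unfolding Q_def using proj_props[where S = "SS g \<alpha>", OF ex[OF that(2)], of \<xi>] by (intro proj_le) auto
  qed
  have "\<exists>k<\<rho>. \<forall>\<alpha><\<rho>. Q k j \<le> Q \<alpha> j" for j
  proof -
    have "Q \<theta> j \<in> (\<lambda>i. Q i j) ` {..<\<rho>}" unfolding \<rho>_def using nextc_gt[OF cf_mu] by auto
    then have "(LEAST y. y \<in> (\<lambda>i. Q i j) ` {..<\<rho>}) \<in> (\<lambda>i. Q i j) ` {..<\<rho>}" by (rule LeastI)
    moreover have "(LEAST y. y \<in> (\<lambda>i. Q i j) ` {..<\<rho>}) \<le> Q i j" if "i < \<rho>" for i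
      using that by (intro Least_le) auto
    ultimately show ?thesis by force
  qed
  then obtain k where k: "\<And>j. k j < \<rho> \<and> (\<forall>\<alpha><\<rho>. Q (k j) j \<le> Q \<alpha> j)" by metis
  then have "\<exists>\<alpha>\<in>{..<\<rho>}. \<forall>j\<in>{..<\<theta>}. k j < \<alpha>"
    by (intro bounding_image[OF \<rho> card_le_refl]) auto
  then obtain \<alpha> where \<alpha>: "\<alpha> < \<rho>" "\<forall>j<\<theta>. k j < \<alpha>" by auto
  obtain \<alpha>' where \<alpha>': "\<alpha> < \<alpha>'" "\<alpha>' < \<rho>"
    using succ_like_above[OF succ_like_nextc[OF cf_mu infinite_cf], of \<alpha> "\<lambda>x. x"] \<alpha>(1) unfolding \<rho>_def by auto
  have stable: "Q \<alpha> j \<le> Q \<alpha>' j" if "j < \<theta>" for j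
  proof -
    have "Q \<alpha> j \<le> Q (k j) j" using \<alpha>(2) that by (intro Q_anti) (auto simp: less_imp_le)
    then show ?thesis using k[of j] \<alpha>'(2) by (meson order_trans)
  qed
  have "tail_le (incr (w \<alpha>)) (incr \<xi>)" using \<xi> \<alpha>(1) by (intro incr_mono) (simp add: less_imp_le)
  moreover have "tail_le (incr \<xi>) (g \<alpha>)" using gN[OF \<alpha>(1)] unfolding bound_def by blast
  ultimately have "\<exists>j0<\<theta>. \<forall>j. j0 \<le> j \<longrightarrow> j < \<theta> \<longrightarrow> incr (w \<alpha>) j \<le> incr \<xi> j \<and> incr \<xi> j \<le> g \<alpha> j"
    unfolding tail_le_def by (rule tail_conj)
  moreover have "proj (SS g \<alpha>) (w \<alpha>) j \<le> g \<alpha> j"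
    if j: "j < \<theta>" "incr (w \<alpha>) j \<le> incr \<xi> j" "incr \<xi> j \<le> g \<alpha> j" for j
  proof -
    have "proj (SS g \<alpha>) (w \<alpha>) j \<le> Q \<alpha> j"
      unfolding Q_def using proj_props[where S = "SS g \<alpha>", OF ex[OF j(1)], of \<xi>] j(2) by (intro proj_le) auto
    also have "\<dots> \<le> Q \<alpha>' j" by (rule stable[OF j(1)])
    also have "\<dots> \<le> g \<alpha> j" unfolding Q_def using j(3) \<alpha>'(1) by (intro proj_le) (auto simp: SS_def)
    finally show ?thesis .
  qed
  ultimately have "tail_le (proj (SS g \<alpha>) (w \<alpha>)) (g \<alpha>)" unfolding tail_le_def by blast
  then show False using gN[OF \<alpha>(1)] by blast
qed

definition lub :: "'a \<Rightarrow> 'a" where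
  "lub = (SOME g. bound g \<and> (\<forall>j<\<theta>. g j \<le> nextc (nu j)) \<and>
    (\<forall>h. bound h \<longrightarrow> (\<forall>j<\<theta>. h j \<le> g j) \<longrightarrow> tail_le g h))"

lemma lub_props: "bound lub \<and> (\<forall>j<\<theta>. lub j \<le> nextc (nu j)) \<and>
    (\<forall>h. bound h \<longrightarrow> (\<forall>j<\<theta>. h j \<le> lub j) \<longrightarrow> tail_le lub h)"
  unfolding lub_def by (rule someI_ex[OF least_upper_bound])

text \<open>Minimality was obtained only against pointwise smaller bounds; the minimum of
  \<open>h\<close> and \<open>lub\<close> is one of these.\<close>

lemma lub_least:
  assumes "bound h"
  shows "tail_le lub h"
proof -
  have "bound (\<lambda>j. min (h j) (lub j))"
    using assms lub_props tail_le_min unfolding bound_def by blast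
  then have "tail_le lub (\<lambda>j. min (h j) (lub j))" using lub_props by auto
  then show ?thesis unfolding tail_le_def by auto
qed

lemma lub_less_mu: "j < \<theta> \<Longrightarrow> lub j < \<mu>"
  using lub_props nextc_less[OF nu_less nu_infinite] by (meson le_less_trans)

lemma incr_less_lub: "tail_less (incr \<gamma>) lub"
proof -
  obtain \<gamma>' where "\<gamma> < \<gamma>'" using UNIV_no_max by blast
  then show ?thesis using incr_strict lub_props tail_less_le_trans unfolding bound_def by blast
qed

text \<open>Round up into \<open>{\<chi> j, nextc (nu j)}\<close>. Some rounded function is a bound,
  hence at least \<open>lub\<close> on a tail, and so cannot take a value
  \<open>\<chi> j < lub j\<close> there.\<close>

lemma lub_exact:
  shows "\<exists>\<xi>0. \<forall>\<xi>\<ge>\<xi>0. \<exists>j0<\<theta>. \<forall>j. j0 \<le> j \<longrightarrow> j < \<theta> \<longrightarrow> \<chi> j < lub j \<longrightarrow> \<chi> j < incr \<xi> j"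
proof -
  define S where "S j = {\<chi> j, nextc (nu j)}" for j
  have "|S j| \<le>o |{..<\<theta>}|" for j unfolding S_def using infinite_cf by (intro card_le_finite) auto
  moreover have ex: "\<exists>s\<in>S j. incr \<gamma> j \<le> s" if "j < \<theta>" for j \<gamma>
    using incr_bound[OF that, of \<gamma>] by (auto simp: S_def)
  ultimately obtain \<gamma> where "bound (proj S \<gamma>)"
    using bounding_projection[OF cf_mu order_refl, of S] unfolding bound_def by blast
  then have le: "tail_le lub (proj S \<gamma>)" by (rule lub_least)
  have "\<exists>j0<\<theta>. \<forall>j. j0 \<le> j \<longrightarrow> j < \<theta> \<longrightarrow> \<chi> j < lub j \<longrightarrow> \<chi> j < incr \<xi> j" if "\<gamma> \<le> \<xi>" for \<xi>
  proof -
    have "\<exists>j0<\<theta>. \<forall>j. j0 \<le> j \<longrightarrow> j < \<theta> \<longrightarrow> lub j \<le> proj S \<gamma> j \<and> incr \<gamma> j \<le> incr \<xi> j"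
      using le incr_mono[OF that] unfolding tail_le_def by (rule tail_conj)
    moreover have "\<chi> j < incr \<xi> j" if "lub j \<le> proj S \<gamma> j" "incr \<gamma> j \<le> incr \<xi> j" "\<chi> j < lub j" for j
    proof (rule ccontr)
      assume "\<not> ?thesis"
      then have "proj S \<gamma> j \<le> \<chi> j" using that(2) by (intro proj_le) (auto simp: S_def)
      then show False using that by simp
    qed
    ultimately show ?thesis by blast
  qed
  then show ?thesis by blast
qed

text \<open>If small cofinal subsets of \<open>lub j\<close> existed for unboundedly many
  \<open>j\<close>, rounding up into them would yield a bound lying below \<open>lub\<close> at
  unboundedly many coordinates.\<close>

lemma lub_cofinality:
  assumes "w < \<mu>"
  shows "\<exists>j0<\<theta>. \<forall>j. j0 \<le> j \<longrightarrow> j < \<theta> \<longrightarrow> bounding w {..<lub j}"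
proof (rule ccontr)
  assume "\<not> ?thesis"
  then have bad: "\<exists>j\<ge>j0. j < \<theta> \<and> \<not> bounding w {..<lub j}" if "j0 < \<theta>" for j0 using that by blast
  define v where "v = max w \<theta>"
  have v: "v < \<mu>" "\<theta> \<le> v" using assms cf_mu by (auto simp: v_def)
  have vinf: "infinite {..<v}" using infinite_mono[OF v(2) infinite_cf] .
  have "\<exists>X\<subseteq>{..<lub j}. |X| \<le>o |{..<v}| \<and> (\<forall>c<lub j. \<exists>x\<in>X. c \<le> x)" if "\<not> bounding w {..<lub j}" for j
  proof -
    obtain X where X: "X \<subseteq> {..<lub j}" "|X| \<le>o |{..<w}|" "\<forall>c<lub j. \<exists>x\<in>X. c \<le> x"
      using \<open>\<not> bounding w {..<lub j}\<close> unfolding bounding_def by (auto simp: not_less)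
    have "|X| \<le>o |{..<v}|"
      using card_le_trans[OF X(2) card_lessThan_mono] unfolding v_def by simp
    then show ?thesis using X by blast
  qed
  then obtain X where X: "\<And>j. \<not> bounding w {..<lub j} \<Longrightarrow>
      X j \<subseteq> {..<lub j} \<and> |X j| \<le>o |{..<v}| \<and> (\<forall>c<lub j. \<exists>x\<in>X j. c \<le> x)"
    by metis
  define S where "S j = insert (nextc (nu j)) (if bounding w {..<lub j} then {} else X j)" for j
  have "|S j| \<le>o |{..<v}|" for j
    unfolding S_def using X vinf by (intro card_le_insert) (auto intro: card_le_finite)
  moreover have ex: "\<exists>s\<in>S j. incr \<gamma> j \<le> s" if "j < \<theta>" for j \<gamma>
    using incr_bound[OF that, of \<gamma>] by (auto simp: S_def)
  ultimately obtain \<gamma> where "bound (proj S \<gamma>)"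
    using bounding_projection[OF v, of S] unfolding bound_def by blast
  then have "tail_le lub (proj S \<gamma>)" by (rule lub_least)
  then have "\<exists>j0<\<theta>. \<forall>j. j0 \<le> j \<longrightarrow> j < \<theta> \<longrightarrow> lub j \<le> proj S \<gamma> j \<and> incr \<gamma> j < lub j"
    using incr_less_lub[of \<gamma>] unfolding tail_le_def tail_less_def by (rule tail_conj)
  then obtain j where j: "lub j \<le> proj S \<gamma> j" "incr \<gamma> j < lub j" "\<not> bounding w {..<lub j}"
    using bad by blast
  then obtain x where "x \<in> X j" "incr \<gamma> j \<le> x" "x < lub j" using X by blast
  moreover from this have "proj S \<gamma> j \<le> x" using j(3) by (intro proj_le) (auto simp: S_def)
  ultimately show False using j(1) by simp
qed

text \<open>Coordinates are thinned out: \<open>s k\<close> is chosen so late that the cofinality of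
  \<open>lub (s k)\<close> exceeds the size of all earlier \<open>lub (s i)\<close>. The condition
  \<open>k \<le> s k\<close> turns tails into tails.\<close>

lemma scale_exists:
  shows "\<exists>(f :: 'a \<Rightarrow> 'a \<Rightarrow> 'a) G b. (\<forall>\<xi>. \<forall>k<\<theta>. f \<xi> k < G k)
    \<and> (\<forall>k<\<theta>. G k < \<mu> \<and> \<theta> \<le> b k \<and> b k < \<mu> \<and> (\<forall>i<k. G i \<le> b k) \<and> bounding (b k) {..<G k})
    \<and> (\<forall>\<chi>. (\<forall>k<\<theta>. \<chi> k < G k) \<longrightarrow>
         (\<exists>\<xi>0. \<forall>\<xi>\<ge>\<xi>0. \<exists>j0<\<theta>. \<forall>k. j0 \<le> k \<longrightarrow> k < \<theta> \<longrightarrow> \<chi> k < f \<xi> k))"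
proof -
  define B where "B s k = ssup (insert \<theta> ((\<lambda>i. lub (s i)) ` {..<k}))" for s :: "'a \<Rightarrow> 'a" and k
  define H where "H s k = (SOME j. k \<le> j \<and> j < \<theta> \<and> bounding (B s k) {..<lub j})" for s k
  obtain s where s0: "\<forall>k. s k = H (\<lambda>j. if j < k then s j else undefined) k"
    using wellorder_recursion[of H] by (rule exE)
  have "B (\<lambda>j. if j < k then s j else undefined) k = B s k" for k
    unfolding B_def by (intro arg_cong[where f = ssup] arg_cong2[where f = insert] image_cong) auto
  then have s1: "s k = (SOME j. k \<le> j \<and> j < \<theta> \<and> bounding (B s k) {..<lub j})" for k
    using s0[rule_format, of k] unfolding H_def by simp
  have Bd: "B s k < \<mu> \<and> \<theta> \<le> B s k \<and> (\<forall>i<k. lub (s i) \<le> B s k)" if k: "k < \<theta>" "\<forall>i<k. s i < \<theta>" for k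
  proof -
    have "\<exists>c\<in>{..<\<mu>}. \<forall>i\<in>{..<k}. lub (s i) < c"
      using k lub_less_mu by (intro bounding_image[OF bounding_mu[OF k(1)] card_le_refl]) auto
    then obtain c where c: "c < \<mu>" "\<forall>i<k. lub (s i) < c" by auto
    obtain d where d: "max c \<theta> < d" "d < \<mu>" using mu_limit[of "max c \<theta>"] c(1) cf_mu by auto
    have bd: "\<forall>x\<in>insert \<theta> ((\<lambda>i. lub (s i)) ` {..<k}). x < d" using c d by auto
    have "B s k \<le> d" unfolding B_def using bd by (intro ssup_le) auto
    moreover have "x < B s k" if "x \<in> insert \<theta> ((\<lambda>i. lub (s i)) ` {..<k})" for x
      unfolding B_def using ssup_upper[OF bd that] .
    ultimately show ?thesis using d(2) by (auto simp: less_imp_le)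
  qed
  have s: "k \<le> s k \<and> s k < \<theta> \<and> bounding (B s k) {..<lub (s k)}" if "k < \<theta>" for k
    using that
  proof (induction k rule: less_induct)
    case (less k)
    then have "B s k < \<mu>" using Bd[of k] by simp
    then obtain j0 where "j0 < \<theta>" "\<forall>j. j0 \<le> j \<longrightarrow> j < \<theta> \<longrightarrow> bounding (B s k) {..<lub j}"
      using lub_cofinality by blast
    then have "\<exists>j. k \<le> j \<and> j < \<theta> \<and> bounding (B s k) {..<lub j}"
      using less.prems by (intro exI[of _ "max j0 k"]) auto
    then show ?case unfolding s1[of k] by (rule someI_ex)
  qed
  have B: "B s k < \<mu> \<and> \<theta> \<le> B s k \<and> (\<forall>i<k. lub (s i) \<le> B s k)" if "k < \<theta>" for k
    using Bd[OF that] s that less_trans by blast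
  have pos: "\<exists>c. c < lub (s k)" if "k < \<theta>" for k
    using boundingD[of "B s k" "{..<lub (s k)}" "{}"] s[OF that] by (auto simp: card_of_empty)
  have neq: "s i \<noteq> s k" if "i < k" "k < \<theta>" for i k
  proof
    assume "s i = s k"
    then have "|{..<lub (s k)}| \<le>o |{..<B s k}|" using B[OF that(2)] that(1) card_lessThan_mono by metis
    then have "\<exists>c\<in>{..<lub (s k)}. \<forall>x\<in>{..<lub (s k)}. x < c"
      using s[OF that(2)] by (intro boundingD) auto
    then show False by auto
  qed
  have inj: "inj_on s {..<\<theta>}"
    by (rule linorder_inj_onI') (use neq in auto)
  \<comment> \<open>For each \<xi> the replacement value is used on a bounded set of coordinates
    only, by \<open>incr_less_lub\<close>.\<close>
  define f where "f \<xi> k = (if incr \<xi> (s k) < lub (s k) then incr \<xi> (s k) else (SOME c. c < lub (s k)))" for \<xi> k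
  have f: "f \<xi> k < lub (s k)" if "k < \<theta>" for \<xi> k
    unfolding f_def using someI_ex[OF pos[OF that]] by auto
  have dom: "\<exists>\<xi>0. \<forall>\<xi>\<ge>\<xi>0. \<exists>j0<\<theta>. \<forall>k. j0 \<le> k \<longrightarrow> k < \<theta> \<longrightarrow> \<chi> k < f \<xi> k"
    if \<chi>: "\<forall>k<\<theta>. \<chi> k < lub (s k)" for \<chi>
  proof -
    \<comment> \<open>Moves \<chi> to the original coordinates along the injection \<open>s\<close>;
      off the range of \<open>s\<close> the values are arbitrary.\<close>
    define \<chi>' where "\<chi>' j = \<chi> (the_inv_into {..<\<theta>} s j)" for j
    have \<chi>': "\<chi>' (s k) = \<chi> k" if "k < \<theta>" for k
      unfolding \<chi>'_def using the_inv_into_f_f[OF inj] that by simp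
    obtain \<xi>0 where \<xi>0: "\<forall>\<xi>\<ge>\<xi>0. \<exists>j0<\<theta>. \<forall>j. j0 \<le> j \<longrightarrow> j < \<theta> \<longrightarrow> \<chi>' j < lub j \<longrightarrow> \<chi>' j < incr \<xi> j"
      using lub_exact by blast
    have "\<exists>j0<\<theta>. \<forall>k. j0 \<le> k \<longrightarrow> k < \<theta> \<longrightarrow> \<chi> k < f \<xi> k" if "\<xi>0 \<le> \<xi>" for \<xi>
    proof -
      have "\<exists>j0<\<theta>. \<forall>j. j0 \<le> j \<longrightarrow> j < \<theta> \<longrightarrow> incr \<xi> j < lub j \<and> (\<chi>' j < lub j \<longrightarrow> \<chi>' j < incr \<xi> j)"
        using incr_less_lub[of \<xi>, unfolded tail_less_def] \<xi>0[rule_format, OF that] by (rule tail_conj)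
      then obtain j0 where j0: "j0 < \<theta>"
        "\<And>j. j0 \<le> j \<Longrightarrow> j < \<theta> \<Longrightarrow> incr \<xi> j < lub j \<and> (\<chi>' j < lub j \<longrightarrow> \<chi>' j < incr \<xi> j)"
        by blast
      have "\<chi> k < f \<xi> k" if k: "j0 \<le> k" "k < \<theta>" for k
        using j0(2)[OF order_trans[OF k(1)], of "s k"] s[OF k(2)] \<chi>'[OF k(2)] \<chi> k unfolding f_def by auto
      then show ?thesis using j0(1) by blast
    qed
    then show ?thesis by blast
  qed
  show ?thesis
    using f s B dom lub_less_mu
    by (intro exI[of _ f] exI[of _ "\<lambda>k. lub (s k)"] exI[of _ "B s"]) auto
qed

end

section \<open>A coloring with \<open>cf \<mu>\<close> colors\<close>

context singular_successor
begin

lemma tail_uniform: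
  assumes "|B| <o |{..<\<theta>}|" "\<And>x. x \<in> B \<Longrightarrow> \<exists>j0<\<theta>. \<forall>j. j0 \<le> j \<longrightarrow> j < \<theta> \<longrightarrow> P x j"
  shows "\<exists>j0<\<theta>. \<forall>j. j0 \<le> j \<longrightarrow> j < \<theta> \<longrightarrow> (\<forall>x\<in>B. P x j)"
proof -
  obtain v where v: "|B| \<le>o |{..<v}|" "bounding v {..<\<theta>}" using bounding_cf'[OF assms(1)] by metis
  obtain k where k: "\<And>x. x \<in> B \<Longrightarrow> k x < \<theta> \<and> (\<forall>j. k x \<le> j \<longrightarrow> j < \<theta> \<longrightarrow> P x j)"
    using assms(2) by metis
  have "\<exists>j\<in>{..<\<theta>}. \<forall>x\<in>B. k x < j" using k by (intro bounding_image[OF v(2,1)]) auto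
  then obtain j0 where j0: "j0 < \<theta>" "\<forall>x\<in>B. k x < j0" by auto
  have "P x j" if "j0 \<le> j" "j < \<theta>" "x \<in> B" for x j
  proof -
    have "k x \<le> j" using j0(2) that by (meson less_imp_le less_le_trans)
    then show ?thesis using k that by blast
  qed
  then show ?thesis using j0(1) by blast
qed

text \<open>An injection of triples into \<theta> gives every pair a fibre of size
  \<open>|\<theta>|\<close>, and a bounded subset of \<theta> is smaller than that.\<close>

lemma cofinal_fibres:
  "\<exists>h :: 'a \<Rightarrow> 'a \<times> 'a. \<forall>c\<in>{..<\<theta>} \<times> {..<\<theta>}. \<forall>j<\<theta>. \<exists>i<\<theta>. j \<le> i \<and> h i = c"
proof -
  let ?P = "({..<\<theta>} \<times> {..<\<theta>}) \<times> {..<\<theta>}"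
  have "|?P| \<le>o |{..<\<theta>}|" by (intro card_le_Times infinite_cf card_le_refl)
  then obtain e where e: "inj_on e ?P" "e ` ?P \<subseteq> {..<\<theta>}" by (auto simp: card_of_ordLeq[symmetric])
  define h where "h i = fst (inv_into ?P e i)" for i
  have "\<exists>i<\<theta>. j \<le> i \<and> h i = c" if c: "c \<in> {..<\<theta>} \<times> {..<\<theta>}" and j: "j < \<theta>" for c j
  proof -
    have "\<exists>k<\<theta>. j \<le> e (c, k)"
    proof (rule ccontr)
      assume "\<not> ?thesis"
      then have "(\<lambda>k. e (c, k)) ` {..<\<theta>} \<subseteq> {..<j}" by (auto simp: not_le)
      moreover have "inj_on (\<lambda>k. e (c, k)) {..<\<theta>}"
        using e(1) c by (auto simp: inj_on_def)
      ultimately have "|{..<\<theta>}| \<le>o |{..<j}|" by (rule card_leI[rotated])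
      then show False using card_below_cf[OF j] by simp
    qed
    then obtain k where k: "k < \<theta>" "j \<le> e (c, k)" by auto
    have "(c, k) \<in> ?P" using c k by simp
    then have "h (e (c, k)) = c" "e (c, k) < \<theta>" using e unfolding h_def by auto
    then show ?thesis using k(2) by blast
  qed
  then show ?thesis by blast
qed

text \<open>By disjointness at most \<mu> members meet \<open>{..x}\<close>, while there are \<mu>^+
  indices.\<close>

lemma disjoint_family_far:
  assumes disj: "\<And>\<alpha> \<beta>. \<alpha> \<noteq> \<beta> \<Longrightarrow> t \<alpha> \<inter> t \<beta> = ({} :: 'a set)"
  shows "\<exists>\<beta>>x. t \<beta> \<subseteq> {x<..}"
proof -
  define B where "B = {\<beta>. t \<beta> \<inter> {..x} \<noteq> {}}"
  define p where "p \<beta> = (SOME z. z \<in> t \<beta> \<inter> {..x})" for \<beta>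
  have p: "p \<beta> \<in> t \<beta> \<inter> {..x}" if "\<beta> \<in> B" for \<beta>
  proof -
    have "\<exists>z. z \<in> t \<beta> \<inter> {..x}" using that unfolding B_def by blast
    then show ?thesis unfolding p_def by (rule someI_ex)
  qed
  have le: "|{..x}| \<le>o |{..<\<mu>}|"
  proof -
    obtain y where "x < y" using UNIV_no_max by blast
    then show ?thesis using card_segment_le[of y] by (intro card_le_subset[of "{..x}" "{..<y}"]) auto
  qed
  have "inj_on p B" using p disj by (intro inj_onI) (metis IntD1 disjoint_iff)
  moreover have "p ` B \<subseteq> {..x}" using p by blast
  ultimately have "|B| \<le>o |{..x}|" by (rule card_leI)
  then have "|B \<union> {..x}| \<le>o |{..<\<mu>}|" using le infinite_mu card_le_trans by (intro card_le_Un) blast+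
  then have "B \<union> {..x} \<noteq> UNIV" using card_UNIV_not_le by metis
  then obtain \<beta> where "\<beta> \<notin> B" "\<not> \<beta> \<le> x" by auto
  then show ?thesis unfolding B_def by (intro exI[of _ \<beta>]) (auto simp: not_le)
qed

text \<open>\<open>\<Gamma>\<close> maps \<open>(\<zeta>, \<xi>)\<close> to the last coordinate at which \<open>f \<zeta>\<close> is not below \<open>f \<xi>\<close>, for \<open>f\<close> a scale,
  followed by a map with cofinal fibres. Since \<open>\<alpha>\<close> can be found in a set of size less than \<open>G j\<close> for every
  later coordinate \<open>j\<close>, large \<open>\<xi>\<close> dominate the \<open>f \<zeta>\<close> there, while coordinate \<open>i\<close> itself is unrestricted.\<close>

lemma rectangular_coloring:
  "\<exists>\<Gamma> :: 'a \<Rightarrow> 'a \<Rightarrow> 'a \<times> 'a. \<forall>t. (\<forall>\<alpha>. |t \<alpha>| <o |{..<\<theta>}| ) \<longrightarrow> (\<forall>\<alpha> \<beta>. \<alpha> \<noteq> \<beta> \<longrightarrow> t \<alpha> \<inter> t \<beta> = {}) \<longrightarrow>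
    (\<forall>a. \<exists>\<beta>0. \<forall>\<beta>. t \<beta> \<subseteq> {\<beta>0..} \<longrightarrow> (\<forall>c\<in>{..<\<theta>} \<times> {..<\<theta>}.
      \<exists>\<alpha>. a < \<alpha> \<and> \<alpha> < \<beta>0 \<and> t \<alpha> \<subseteq> {a<..} \<and> (\<forall>\<zeta>\<in>t \<alpha>. \<forall>\<xi>\<in>t \<beta>. \<Gamma> \<zeta> \<xi> = c)))"
proof -
  obtain f :: "'a \<Rightarrow> 'a \<Rightarrow> 'a" and G b where scale:
    "(\<forall>\<xi>. \<forall>k<\<theta>. f \<xi> k < G k)
    \<and> (\<forall>k<\<theta>. G k < \<mu> \<and> \<theta> \<le> b k \<and> b k < \<mu> \<and> (\<forall>i<k. G i \<le> b k) \<and> bounding (b k) {..<G k})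
    \<and> (\<forall>\<chi>. (\<forall>k<\<theta>. \<chi> k < G k) \<longrightarrow>
         (\<exists>\<xi>0. \<forall>\<xi>\<ge>\<xi>0. \<exists>j0<\<theta>. \<forall>k. j0 \<le> k \<longrightarrow> k < \<theta> \<longrightarrow> \<chi> k < f \<xi> k))"
    using scale_exists by blast
  have f: "f \<xi> k < G k" if "k < \<theta>" for \<xi> k using scale that by blast
  have G: "G k < \<mu> \<and> \<theta> \<le> b k \<and> b k < \<mu> \<and> (\<forall>i<k. G i \<le> b k) \<and> bounding (b k) {..<G k}" if "k < \<theta>" for k
    using scale that by blast
  have dom: "\<exists>\<xi>0. \<forall>\<xi>\<ge>\<xi>0. \<exists>j0<\<theta>. \<forall>k. j0 \<le> k \<longrightarrow> k < \<theta> \<longrightarrow> \<chi> k < f \<xi> k"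
    if "\<forall>k<\<theta>. \<chi> k < G k" for \<chi>
    using scale that by blast
  obtain h :: "'a \<Rightarrow> 'a \<times> 'a" where h: "\<forall>c\<in>{..<\<theta>} \<times> {..<\<theta>}. \<forall>j<\<theta>. \<exists>i<\<theta>. j \<le> i \<and> h i = c"
    using cofinal_fibres by blast
  define last where "last \<zeta> \<xi> i \<longleftrightarrow> i < \<theta> \<and> f \<xi> i \<le> f \<zeta> i \<and> (\<forall>j. i < j \<longrightarrow> j < \<theta> \<longrightarrow> f \<zeta> j < f \<xi> j)" for \<zeta> \<xi> i
  have last_unique: "i = i'" if "last \<zeta> \<xi> i" "last \<zeta> \<xi> i'" for \<zeta> \<xi> i i'
    using that unfolding last_def by (metis linorder_neqE not_le)
  define \<Gamma> where "\<Gamma> \<zeta> \<xi> = h (SOME i. last \<zeta> \<xi> i)" for \<zeta> \<xi>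
  have \<Gamma>: "\<Gamma> \<zeta> \<xi> = h i" if "last \<zeta> \<xi> i" for \<zeta> \<xi> i
    unfolding \<Gamma>_def using last_unique[OF _ that] someI[of "last \<zeta> \<xi>", OF that] by metis
  have "\<exists>\<beta>0. \<forall>\<beta>. t \<beta> \<subseteq> {\<beta>0..} \<longrightarrow> (\<forall>c\<in>{..<\<theta>} \<times> {..<\<theta>}.
      \<exists>\<alpha>. a < \<alpha> \<and> \<alpha> < \<beta>0 \<and> t \<alpha> \<subseteq> {a<..} \<and> (\<forall>\<zeta>\<in>t \<alpha>. \<forall>\<xi>\<in>t \<beta>. \<Gamma> \<zeta> \<xi> = c))"
    if t: "\<forall>\<alpha>. |t \<alpha>| <o |{..<\<theta>}|" "\<forall>\<alpha> \<beta>. \<alpha> \<noteq> \<beta> \<longrightarrow> t \<alpha> \<inter> t \<beta> = {}" for t a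
  proof -
    define T where "T = {\<alpha>. a < \<alpha> \<and> t \<alpha> \<subseteq> {a<..}}"
    \<comment> \<open>At a rich coordinate some \<open>t \<alpha>\<close> can be lifted above any
      value that \<open>t \<beta>\<close> takes there. Unboundedly many poor coordinates would give
      a function \<chi> that no set \<open>t \<alpha>\<close> lying far enough out
      dominates.\<close>
    define rich where "rich i \<longleftrightarrow> (\<forall>\<eta><G i. \<exists>\<alpha>\<in>T. \<forall>\<zeta>\<in>t \<alpha>. \<eta> \<le> f \<zeta> i)" for i
    have "\<exists>i1<\<theta>. \<forall>i. i1 \<le> i \<longrightarrow> i < \<theta> \<longrightarrow> rich i"
    proof (rule ccontr)
      assume "\<not> ?thesis"
      then have bad: "\<exists>i\<ge>i1. i < \<theta> \<and> \<not> rich i" if "i1 < \<theta>" for i1 using that by blast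
      define \<chi> where "\<chi> i = (if rich i then f a i else (SOME \<eta>. \<eta> < G i \<and> (\<forall>\<alpha>\<in>T. \<exists>\<zeta>\<in>t \<alpha>. \<not> \<eta> \<le> f \<zeta> i)))" for i
      have \<chi>: "\<chi> i < G i \<and> (\<forall>\<alpha>\<in>T. \<exists>\<zeta>\<in>t \<alpha>. \<not> \<chi> i \<le> f \<zeta> i)" if "\<not> rich i" for i
      proof -
        have "\<exists>\<eta>. \<eta> < G i \<and> (\<forall>\<alpha>\<in>T. \<exists>\<zeta>\<in>t \<alpha>. \<not> \<eta> \<le> f \<zeta> i)" using that unfolding rich_def by auto
        from someI_ex[OF this] show ?thesis using that unfolding \<chi>_def by simp
      qed
      have "\<forall>k<\<theta>. \<chi> k < G k"
      proof (intro allI impI)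
        fix k assume "k < \<theta>"
        then show "\<chi> k < G k" using \<chi>[of k] f[of k a] by (cases "rich k") (auto simp: \<chi>_def)
      qed
      from dom[OF this] obtain \<xi>0 where
        \<xi>0: "\<And>\<xi>. \<xi>0 \<le> \<xi> \<Longrightarrow> \<exists>j0<\<theta>. \<forall>k. j0 \<le> k \<longrightarrow> k < \<theta> \<longrightarrow> \<chi> k < f \<xi> k" by blast
      obtain \<alpha> where \<alpha>: "max a \<xi>0 < \<alpha>" "t \<alpha> \<subseteq> {max a \<xi>0<..}"
        using disjoint_family_far[of t "max a \<xi>0"] t(2) by auto
      have "\<exists>j0<\<theta>. \<forall>k. j0 \<le> k \<longrightarrow> k < \<theta> \<longrightarrow> \<chi> k < f \<zeta> k" if "\<zeta> \<in> t \<alpha>" for \<zeta>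
      proof -
        have "\<xi>0 \<le> \<zeta>" using subsetD[OF \<alpha>(2) that] by (simp add: less_imp_le)
        then show ?thesis by (rule \<xi>0)
      qed
      from tail_uniform[OF spec[OF t(1)], of \<alpha> "\<lambda>x k. \<chi> k < f x k", OF this] obtain j0 where
        j0: "j0 < \<theta>" "\<And>k. j0 \<le> k \<Longrightarrow> k < \<theta> \<Longrightarrow> \<forall>\<zeta>\<in>t \<alpha>. \<chi> k < f \<zeta> k" by auto
      obtain i where i: "j0 \<le> i" "i < \<theta>" "\<not> rich i" using bad[OF j0(1)] by blast
      have "\<alpha> \<in> T" using \<alpha> unfolding T_def by auto
      then obtain \<zeta> where "\<zeta> \<in> t \<alpha>" "\<not> \<chi> i \<le> f \<zeta> i" using \<chi>[OF i(3)] by blast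
      then show False using j0(2)[OF i(1,2)] by (auto simp: less_imp_le)
    qed
    then obtain i1 where i1: "i1 < \<theta>" "\<And>i. i1 \<le> i \<Longrightarrow> i < \<theta> \<Longrightarrow> rich i" by blast
    define al where "al i \<eta> = (SOME \<alpha>. \<alpha> \<in> T \<and> (\<forall>\<zeta>\<in>t \<alpha>. \<eta> \<le> f \<zeta> i))" for i \<eta>
    have al: "al i \<eta> \<in> T \<and> (\<forall>\<zeta>\<in>t (al i \<eta>). \<eta> \<le> f \<zeta> i)" if "i1 \<le> i" "i < \<theta>" "\<eta> < G i" for i \<eta>
    proof -
      have "\<exists>\<alpha>. \<alpha> \<in> T \<and> (\<forall>\<zeta>\<in>t \<alpha>. \<eta> \<le> f \<zeta> i)"
        using i1(2)[OF that(1,2)] that(3) unfolding rich_def by auto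
      then show ?thesis unfolding al_def by (rule someI_ex)
    qed
    \<comment> \<open>All candidates attached to coordinates before \<open>j\<close>. Their number
      is at most \<open>|b j|\<close>, so their values at \<open>j\<close> have a common bound below
      \<open>G j\<close>.\<close>
    define Z where "Z j = (\<Union>i\<in>{..<j}. \<Union>\<eta>\<in>{..<G i}. t (al i \<eta>))" for j
    have "\<exists>c\<in>{..<G j}. \<forall>\<zeta>\<in>Z j. f \<zeta> j < c" if j: "j < \<theta>" for j
    proof -
      have inf: "infinite {..<b j}" using G[OF j] infinite_mono infinite_cf by blast
      have th: "|{..<\<theta>}| \<le>o |{..<b j}|" using G[OF j] by (intro card_lessThan_mono) simp
      have "|t (al i \<eta>)| \<le>o |{..<b j}|" for i \<eta>
        using t(1) th ordLess_imp_ordLeq card_le_trans by blast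
      moreover have "j \<le> b j" using G[OF j] j by (meson less_imp_le order_trans)
      ultimately have "|Z j| \<le>o |{..<b j}|"
        unfolding Z_def using G[OF j] by (intro card_le_UN[OF inf] card_lessThan_mono) auto
      then show ?thesis using G[OF j] f[OF j] by (intro bounding_image[of "b j"]) auto
    qed
    then have "\<forall>j. \<exists>c. j < \<theta> \<longrightarrow> c < G j \<and> (\<forall>\<zeta>\<in>Z j. f \<zeta> j < c)" by auto
    then obtain \<chi> where \<chi>: "\<And>j. j < \<theta> \<Longrightarrow> \<chi> j < G j \<and> (\<forall>\<zeta>\<in>Z j. f \<zeta> j < \<chi> j)" by metis
    then have "\<forall>k<\<theta>. \<chi> k < G k" by simp
    from dom[OF this] obtain \<xi>0 where
      \<xi>0: "\<And>\<xi>. \<xi>0 \<le> \<xi> \<Longrightarrow> \<exists>j0<\<theta>. \<forall>k. j0 \<le> k \<longrightarrow> k < \<theta> \<longrightarrow> \<chi> k < f \<xi> k" by blast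
    \<comment> \<open>There are at most \<mu> candidates, whatever \<beta> and \<open>c\<close> will
      be; this makes \<beta>0 independent of both.\<close>
    define U where "U = insert \<xi>0 (\<Union>i\<in>{..<\<theta>}. al i ` {..<G i})"
    have "|U| \<le>o |{..<\<mu>}|"
      unfolding U_def
      by (intro card_le_insert card_le_UN card_le_image infinite_mu card_segment_le)
    then obtain \<beta>0 where \<beta>0: "\<forall>x\<in>U. x < \<beta>0" using boundingD[OF bounding_UNIV] by blast
    have "\<exists>\<alpha>. a < \<alpha> \<and> \<alpha> < \<beta>0 \<and> t \<alpha> \<subseteq> {a<..} \<and> (\<forall>\<zeta>\<in>t \<alpha>. \<forall>\<xi>\<in>t \<beta>. \<Gamma> \<zeta> \<xi> = c)"
      if \<beta>: "t \<beta> \<subseteq> {\<beta>0..}" and c: "c \<in> {..<\<theta>} \<times> {..<\<theta>}" for \<beta> c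
    proof -
      have "\<exists>j0<\<theta>. \<forall>k. j0 \<le> k \<longrightarrow> k < \<theta> \<longrightarrow> \<chi> k < f \<xi> k" if "\<xi> \<in> t \<beta>" for \<xi>
      proof -
        have "\<xi>0 < \<beta>0" using \<beta>0 by (simp add: U_def)
        moreover have "\<beta>0 \<le> \<xi>" using \<beta> that by auto
        ultimately have "\<xi>0 \<le> \<xi>" by simp
        then show ?thesis by (rule \<xi>0)
      qed
      from tail_uniform[OF spec[OF t(1)], of \<beta> "\<lambda>x k. \<chi> k < f x k", OF this] obtain j0 where
        j0: "j0 < \<theta>" "\<And>k. j0 \<le> k \<Longrightarrow> k < \<theta> \<Longrightarrow> \<forall>\<xi>\<in>t \<beta>. \<chi> k < f \<xi> k" by auto
      obtain i where i: "i < \<theta>" "max j0 i1 \<le> i" "h i = c"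
        using h[rule_format, OF c, of "max j0 i1"] j0(1) i1(1) by auto
      have "|t \<beta>| \<le>o |{..<b i}|"
        using t(1) G[OF i(1)] card_lessThan_mono[of \<theta> "b i"] ordLess_imp_ordLeq card_le_trans by blast
      then have "\<exists>\<eta>\<in>{..<G i}. \<forall>\<xi>\<in>t \<beta>. f \<xi> i < \<eta>"
        using G[OF i(1)] f[OF i(1)] by (intro bounding_image[of "b i"]) auto
      then obtain \<eta> where \<eta>: "\<eta> < G i" "\<forall>\<xi>\<in>t \<beta>. f \<xi> i < \<eta>" by auto
      have A: "al i \<eta> \<in> T" "\<forall>\<zeta>\<in>t (al i \<eta>). \<eta> \<le> f \<zeta> i" using al[of i \<eta>] i \<eta>(1) by auto
      have "\<Gamma> \<zeta> \<xi> = c" if z: "\<zeta> \<in> t (al i \<eta>)" "\<xi> \<in> t \<beta>" for \<zeta> \<xi>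
      proof -
        have "f \<xi> i \<le> f \<zeta> i" using A(2) \<eta>(2) z by (meson less_imp_le less_le_trans)
        moreover have "f \<zeta> j < f \<xi> j" if j: "i < j" "j < \<theta>" for j
        proof -
          have "\<zeta> \<in> Z j" unfolding Z_def using z(1) j(1) \<eta>(1) by auto
          then have "f \<zeta> j < \<chi> j" using \<chi>[OF j(2)] by blast
          also have "\<chi> j < f \<xi> j" using j0(2)[of j] j i(2) z(2) by auto
          finally show ?thesis .
        qed
        ultimately have "last \<zeta> \<xi> i" using i(1) by (simp add: last_def)
        then show ?thesis using \<Gamma> i(3) by simp
      qed
      moreover have "al i \<eta> < \<beta>0" using \<beta>0 i(1) \<eta>(1) unfolding U_def by blast
      ultimately show ?thesis using A(1) unfolding T_def by blast
    qed
    then show ?thesis by blast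
  qed
  then show ?thesis by blast
qed

end

section \<open>Ladders and walks\<close>

definition unbounded_in :: "'a::wellorder set \<Rightarrow> 'a \<Rightarrow> bool" where
  "unbounded_in X \<delta> \<longleftrightarrow> (\<exists>z. z < \<delta>) \<and> (\<forall>z<\<delta>. \<exists>x\<in>X. z < x \<and> x < \<delta>)"

context singular_successor
begin

text \<open>The \<theta> pieces cover \<xi>: either one of them is cofinal, or each is bounded and
  the \<theta> bounds are cofinal.\<close>

lemma small_cofinal:
  "\<exists>c\<subseteq>{..<\<xi>::'a}. (\<forall>x<\<xi>. \<exists>y\<in>c. x \<le> y) \<and> (\<exists>v<\<mu>. |c| \<le>o |{..<v}| )"
proof (cases "\<exists>j<\<theta>. \<forall>x<\<xi>. \<exists>y\<in>piece \<xi> j. x \<le> y")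
  case True
  then obtain j where "j < \<theta>" "\<forall>x<\<xi>. \<exists>y\<in>piece \<xi> j. x \<le> y" by blast
  then show ?thesis using piece_below card_piece nu_less
    by (intro exI[of _ "piece \<xi> j"] conjI exI[of _ "nu j"])
next
  case False
  then have "\<forall>j. \<exists>b. j < \<theta> \<longrightarrow> b < \<xi> \<and> (\<forall>y\<in>piece \<xi> j. y < b)" by (auto simp: not_le)
  then obtain b where b: "\<And>j. j < \<theta> \<Longrightarrow> b j < \<xi> \<and> (\<forall>y\<in>piece \<xi> j. y < b j)" by metis
  have "\<exists>y\<in>b ` {..<\<theta>}. x \<le> y" if "x < \<xi>" for x
  proof -
    obtain j where "j < \<theta>" "x \<in> piece \<xi> j" using piece_cover[OF \<open>x < \<xi>\<close>] by blast
    then show ?thesis using b[of j] by (intro bexI[of _ "b j"]) (auto simp: less_imp_le)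
  qed
  moreover have "b ` {..<\<theta>} \<subseteq> {..<\<xi>}" using b by auto
  moreover have "|b ` {..<\<theta>}| \<le>o |{..<\<theta>}|" by (rule card_of_image)
  ultimately show ?thesis using cf_mu by (intro exI[of _ "b ` {..<\<theta>}"] conjI exI[of _ \<theta>]) simp_all
qed

lemma limit_of_cf:
  assumes "cf \<delta> = \<theta>" "z < \<delta>"
  shows "\<exists>y. z < y \<and> y < \<delta>"
proof -
  have "{..<\<theta>} \<noteq> {}" using infinite_cf by auto
  then obtain v where "v < \<theta>" by blast
  then obtain w where "v < w" "w < \<theta>" using cf_limit by blast
  then have b: "bounding w {..<\<delta>}" using bounding_below_cf assms(1) by metis
  have "z \<in> (\<lambda>_. z) ` {..<w}" using \<open>v < w\<close> by auto
  then have "|{z}| \<le>o |{..<w}|"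
    by (intro card_le_subset[OF _ card_of_image[of "\<lambda>_. z" "{..<w}"]]) simp
  then have "\<exists>c\<in>{..<\<delta>}. \<forall>x\<in>{z}. x < c"
    using assms(2) by (intro boundingD[OF b]) auto
  then show ?thesis by auto
qed

lemma pos_of_cf: "cf \<delta> = \<theta> \<Longrightarrow> \<exists>z. z < \<delta>"
proof (rule ccontr)
  assume c: "cf \<delta> = \<theta>" "\<nexists>z. z < \<delta>"
  then have "cf \<delta> \<le> \<delta>" by (intro cf_le[of \<delta> "\<lambda>x. x"]) auto
  then have "{..<\<theta>} \<subseteq> {..<\<delta>}" using c(1) by auto
  also have "{..<\<delta>} = {}" using c(2) by auto
  finally show False using infinite_cf by simp
qed

text \<open>Add \<open>C \<delta>\<close> for all limits \<delta> reached so far,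
  \<open>nextc \<theta>\<close> times. A \<delta> of cofinality \<theta> that is reached by the
  union is reached at an earlier stage. The size stays below \<mu> because a set has few limit
  points.\<close>

lemma swallowing_ladder:
  assumes cf: "\<And>\<delta>. \<delta> \<in> S \<Longrightarrow> cf \<delta> = \<theta>"
    and C: "\<And>\<delta>. \<delta> \<in> S \<Longrightarrow> C \<delta> \<subseteq> {..<\<delta>} \<and> |C \<delta>| \<le>o |{..<\<kappa>}|"
    and \<kappa>: "\<kappa> < \<mu>"
  shows "\<exists>e\<subseteq>{..<\<xi>}. (\<forall>x<\<xi>. \<exists>y\<in>e. x \<le> y) \<and> (\<exists>v<\<mu>. |e| \<le>o |{..<v}| )
    \<and> (\<forall>\<delta>\<in>S. \<delta> \<le> \<xi> \<longrightarrow> unbounded_in e \<delta> \<longrightarrow> C \<delta> \<subseteq> e)"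
proof -
  obtain c v where c: "c \<subseteq> {..<\<xi>}" "\<forall>x<\<xi>. \<exists>y\<in>c. x \<le> y" "v < \<mu>" "|c| \<le>o |{..<v}|"
    using small_cofinal by meson
  define \<rho> where "\<rho> = nextc \<theta>"
  have \<rho>: "\<rho> < \<mu>" "\<theta> < \<rho>" "bounding \<theta> {..<\<rho>}" unfolding \<rho>_def
    using nextc_less[OF cf_mu infinite_cf] nextc_gt[OF cf_mu] bounding_nextc[OF cf_mu infinite_cf] by auto
  define w where "w = max v (max \<kappa> \<rho>)"
  have w: "w < \<mu>" "v \<le> w" "\<kappa> \<le> w" "\<rho> \<le> w" using c(3) \<kappa> \<rho>(1) by (auto simp: w_def le_max_iff_disj)
  have winf: "infinite {..<w}" using infinite_mono[OF _ infinite_cf] w(4) \<rho>(2) by (meson less_imp_le order_trans)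
  define G where "G Y = Y \<union> (\<Union>\<delta>\<in>{\<delta>\<in>S. \<delta> \<le> \<xi> \<and> unbounded_in Y \<delta>}. C \<delta>)" for Y
  define H where "H X k = c \<union> (\<Union>j\<in>{..<k}. G (X j))" for X and k :: 'a
  obtain X where X0: "\<forall>k. X k = H (\<lambda>j. if j < k then X j else undefined) k"
    using wellorder_recursion[of H] by (rule exE)
  have "H (\<lambda>j. if j < k then X j else undefined) k = c \<union> (\<Union>j\<in>{..<k}. G (X j))" for k
    by (simp add: H_def)
  then have X: "X k = c \<union> (\<Union>j\<in>{..<k}. G (X j))" for k using X0 by metis
  have G_card: "|G Y| \<le>o |{..<w}|" if Y: "|Y| \<le>o |{..<w}|" for Y
  proof -
    obtain \<gamma> where \<gamma>: "\<xi> < \<gamma>" using UNIV_no_max by blast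
    have "{\<delta>\<in>S. \<delta> \<le> \<xi> \<and> unbounded_in Y \<delta>} \<subseteq> limit_closure \<gamma> Y"
      using \<gamma> by (auto simp: limit_closure_def unbounded_in_def)
    then have "|{\<delta>\<in>S. \<delta> \<le> \<xi> \<and> unbounded_in Y \<delta>}| \<le>o |{..<w}|"
      using card_limit_closure[OF winf Y] by (rule card_le_subset)
    moreover have "|C \<delta>| \<le>o |{..<w}|" if "\<delta> \<in> S" for \<delta>
      using C[OF that] card_lessThan_mono[OF w(3)] card_le_trans by blast
    ultimately show ?thesis unfolding G_def by (intro card_le_Un[OF winf Y] card_le_UN[OF winf]) auto
  qed
  have X_card: "|X k| \<le>o |{..<w}|" if "k < \<rho>" for k
    using that
  proof (induction k rule: less_induct)
    case (less k)
    have "|{..<k}| \<le>o |{..<w}|" using less.prems w(4) by (intro card_lessThan_mono) simp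
    moreover have "|c| \<le>o |{..<w}|" using c(4) card_lessThan_mono[OF w(2)] card_le_trans by blast
    ultimately show ?case unfolding X[of k] using less by (intro card_le_Un[OF winf] card_le_UN[OF winf] G_card) auto
  qed
  have X_below: "X k \<subseteq> {..<\<xi>}" for k
  proof (induction k rule: less_induct)
    case (less k)
    have "C \<delta> \<subseteq> {..<\<xi>}" if "\<delta> \<in> S" "\<delta> \<le> \<xi>" for \<delta> using C[OF that(1)] that(2) by auto
    then have "G (X j) \<subseteq> {..<\<xi>}" if "j < k" for j using less[OF that] unfolding G_def by blast
    then show ?case unfolding X[of k] using c(1) by blast
  qed
  have X_mono: "X j \<subseteq> X k" if "j \<le> k" for j k unfolding X[of j] X[of k] using that by auto
  define e where "e = (\<Union>k\<in>{..<\<rho>}. X k)"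
  have "e \<subseteq> {..<\<xi>}" using X_below unfolding e_def by blast
  moreover have "c \<subseteq> e" unfolding e_def using X[of \<theta>] \<rho>(2) by blast
  then have "\<forall>x<\<xi>. \<exists>y\<in>e. x \<le> y" using c(2) by blast
  moreover have "|e| \<le>o |{..<w}|"
    unfolding e_def using X_card by (intro card_le_UN[OF winf] card_lessThan_mono[OF w(4)]) auto
  moreover have "C \<delta> \<subseteq> e" if \<delta>: "\<delta> \<in> S" "\<delta> \<le> \<xi>" "unbounded_in e \<delta>" for \<delta>
  proof -
    obtain g where g: "\<forall>i<\<theta>. g i < \<delta>" "\<forall>x<\<delta>. \<exists>i<\<theta>. x \<le> g i"
      using cf_cofinal_map[of \<delta>] cf[OF \<delta>(1)] by auto
    have "\<forall>i. \<exists>y k. i < \<theta> \<longrightarrow> g i < y \<and> y < \<delta> \<and> k < \<rho> \<and> y \<in> X k"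
    proof
      fix i
      show "\<exists>y k. i < \<theta> \<longrightarrow> g i < y \<and> y < \<delta> \<and> k < \<rho> \<and> y \<in> X k"
      proof (cases "i < \<theta>")
        case True
        then obtain y where "y \<in> e" "g i < y" "y < \<delta>" using \<delta>(3) g(1) unfolding unbounded_in_def by blast
        then show ?thesis unfolding e_def by auto
      qed simp
    qed
    then obtain y k where yk: "\<And>i. i < \<theta> \<Longrightarrow> g i < y i \<and> y i < \<delta> \<and> k i < \<rho> \<and> y i \<in> X (k i)" by metis
    have "\<exists>m\<in>{..<\<rho>}. \<forall>i\<in>{..<\<theta>}. k i < m"
      using yk by (intro bounding_image[OF \<rho>(3) card_le_refl]) auto
    then obtain m where m: "m < \<rho>" "\<forall>i<\<theta>. k i < m" by auto
    have "unbounded_in (X m) \<delta>"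
      unfolding unbounded_in_def
    proof (intro conjI allI impI)
      show "\<exists>z. z < \<delta>" using \<delta>(3) by (simp add: unbounded_in_def)
      fix z assume "z < \<delta>"
      then obtain i where "i < \<theta>" "z \<le> g i" using g(2) by blast
      moreover from this have "y i \<in> X m" using yk[of i] X_mono[of "k i" m] m(2) by (auto simp: less_imp_le)
      ultimately show "\<exists>x\<in>X m. z < x \<and> x < \<delta>" using yk[of i] by (intro bexI[of _ "y i"]) auto
    qed
    then have "C \<delta> \<subseteq> G (X m)" using \<delta>(1,2) unfolding G_def by blast
    moreover obtain m' where "m < m'" "m' < \<rho>"
      using succ_like_above[OF succ_like_nextc[OF cf_mu infinite_cf], of m "\<lambda>x. x"] m(1) unfolding \<rho>_def by auto
    moreover from this have "G (X m) \<subseteq> X m'" using X[of m'] by blast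
    ultimately show ?thesis unfolding e_def by blast
  qed
  ultimately show ?thesis using w(1) by (intro exI[of _ e] conjI exI[of _ w]) auto
qed

end

section \<open>Walks along a fixed system of small ladders\<close>

locale ladder_system = singular_successor \<mu> for \<mu> :: "'a::wellorder" +
  fixes e :: "'a \<Rightarrow> 'a set"
  assumes ladder_below: "e \<xi> \<subseteq> {..<\<xi>}"
    and ladder_cofinal: "x < \<xi> \<Longrightarrow> \<exists>y\<in>e \<xi>. x \<le> y"
    and ladder_small: "\<exists>v<\<mu>. |e \<xi>| \<le>o |{..<v}|"
begin

definition nxt :: "'a \<Rightarrow> 'a \<Rightarrow> 'a" where
  "nxt z x = (LEAST y. y \<in> e x \<and> z \<le> y)"

lemma nxt_props:
  assumes "z < x"
  shows "nxt z x \<in> e x" "z \<le> nxt z x" "nxt z x < x"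
proof -
  have "\<exists>y. y \<in> e x \<and> z \<le> y" using ladder_cofinal[OF assms] by blast
  then have "nxt z x \<in> e x \<and> z \<le> nxt z x" unfolding nxt_def by (rule LeastI_ex)
  then show "nxt z x \<in> e x" "z \<le> nxt z x" "nxt z x < x" using ladder_below by auto
qed

lemma nxt_eq:
  assumes "y \<in> e x" "z \<le> y" "\<And>y'. y' \<in> e x \<Longrightarrow> z \<le> y' \<Longrightarrow> y \<le> y'"
  shows "nxt z x = y"
  unfolding nxt_def using assms by (intro Least_equality) auto

text \<open>\<open>stop w z x\<close> is the first point of the walk from \<open>x\<close> down to \<open>z\<close> along \<open>e\<close> whose ladder
  has more than \<open>|w|\<close> elements.\<close>

definition stop :: "'a \<Rightarrow> 'a \<Rightarrow> 'a \<Rightarrow> 'a" where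
  "stop = (SOME N. \<forall>w z x. N w z x = (if x \<le> z \<or> \<not> |e x| \<le>o |{..<w}| then x else N w z (nxt z x)))"

lemma stop_rec: "stop w z x = (if x \<le> z \<or> \<not> |e x| \<le>o |{..<w}| then x else stop w z (nxt z x))"
proof -
  define H where "H f x = (\<lambda>w z. if x \<le> z \<or> \<not> |e x| \<le>o |{..<w}| then x else f (nxt z x) w z)"
    for f :: "'a \<Rightarrow> 'a \<Rightarrow> 'a \<Rightarrow> 'a" and x
  obtain N where N: "\<forall>x. N x = H (\<lambda>j. if j < x then N j else undefined) x"
    using wellorder_recursion[of H] by (rule exE)
  have "H (\<lambda>j. if j < x then N j else undefined) x w z =
      (if x \<le> z \<or> \<not> |e x| \<le>o |{..<w}| then x else N (nxt z x) w z)" for x w z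
    unfolding H_def using nxt_props(3)[of z x] by (auto simp: not_le)
  then have "N x w z = (if x \<le> z \<or> \<not> |e x| \<le>o |{..<w}| then x else N (nxt z x) w z)" for x w z
    using fun_cong[OF fun_cong[OF spec[OF N, of x], of w], of z] by (rule trans[rotated])
  then have "\<exists>N :: 'a \<Rightarrow> 'a \<Rightarrow> 'a \<Rightarrow> 'a. \<forall>w z x. N w z x = (if x \<le> z \<or> \<not> |e x| \<le>o |{..<w}| then x else N w z (nxt z x))"
    by (intro exI[of _ "\<lambda>w z x. N x w z"] allI)
  from someI_ex[OF this] show ?thesis unfolding stop_def[symmetric] by (elim allE)
qed

text \<open>A node passed at threshold \<open>w1\<close> is also passed at \<open>w2\<close>, so the
  second decoding may resume where the first one stopped.\<close>

lemma stop_stop: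
  assumes "w1 \<le> w2"
  shows "stop w2 z (stop w1 z x) = stop w2 z x"
proof (induction x rule: less_induct)
  case (less x)
  show ?case
  proof (cases "x \<le> z \<or> \<not> |e x| \<le>o |{..<w1}|")
    case True
    then show ?thesis by (subst stop_rec[of w1]) simp
  next
    case False
    then have "|e x| \<le>o |{..<w2}|" using card_lessThan_mono[OF assms] card_le_trans by blast
    then have "stop w2 z x = stop w2 z (nxt z x)" "stop w1 z x = stop w1 z (nxt z x)"
      using False stop_rec[of w2 z x] stop_rec[of w1 z x] by auto
    then show ?thesis using less[of "nxt z x"] nxt_props(3)[of z x] False by (simp add: not_le)
  qed
qed

text \<open>The ladder is cofinal in \<gamma>, hence has more than \<open>|w|\<close>
  elements.\<close>

lemma stop_at_large_cf:
  assumes "w < cf \<gamma>"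
  shows "stop w z \<gamma> = \<gamma>"
proof -
  have "\<not> |e \<gamma>| \<le>o |{..<w}|"
  proof
    assume "|e \<gamma>| \<le>o |{..<w}|"
    then have "\<exists>c\<in>{..<\<gamma>}. \<forall>x\<in>e \<gamma>. x < c"
      using ladder_below by (intro boundingD[OF bounding_below_cf[OF assms]])
    then show False using ladder_cofinal[of _ \<gamma>] by (meson lessThan_iff not_le)
  qed
  then show ?thesis using stop_rec by simp
qed

text \<open>\<open>v\<close> dominates the sizes of the finitely many ladders used before \<gamma>,
  so nothing stops the walk earlier. The threshold stays free between \<open>v\<close> and
  \<open>cf \<gamma>\<close>, since it is later taken of the form \<open>nu i\<close>.\<close>

lemma walk_through:
  assumes cf: "cf \<delta> = \<theta>" and C: "C \<subseteq> {..<\<delta>}"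
    and swallow: "\<And>\<xi>. \<delta> \<le> \<xi> \<Longrightarrow> unbounded_in (e \<xi>) \<delta> \<Longrightarrow> C \<subseteq> e \<xi>"
    and "\<delta> \<le> \<xi>"
  shows "\<exists>a<\<delta>. \<exists>v<\<mu>. \<forall>w. v \<le> w \<longrightarrow> (\<forall>\<gamma>\<in>C. a < \<gamma> \<longrightarrow> w < cf \<gamma> \<longrightarrow>
    (\<exists>c<\<gamma>. \<forall>z. c < z \<longrightarrow> z < \<gamma> \<longrightarrow> stop w z \<xi> = \<gamma>))"
  using assms(4)
proof (induction \<xi> rule: less_induct)
  case (less \<xi>)
  obtain v where v: "v < \<mu>" "|e \<xi>| \<le>o |{..<v}|" using ladder_small by blast
  obtain z0 where z0: "z0 < \<delta>" using pos_of_cf[OF cf] by blast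
  show ?case
  proof (cases "unbounded_in (e \<xi>) \<delta>")
    case True
    then have sub: "C \<subseteq> e \<xi>" using swallow less.prems by blast
    have "\<exists>c<\<gamma>. \<forall>z. c < z \<longrightarrow> z < \<gamma> \<longrightarrow> stop w z \<xi> = \<gamma>"
      if \<gamma>: "v \<le> w" "\<gamma> \<in> C" "w < cf \<gamma>" for w \<gamma>
    proof -
      have le: "|e \<xi>| \<le>o |{..<w}|" using v(2) card_lessThan_mono[OF \<gamma>(1)] card_le_trans by blast
      \<comment> \<open>The part of the ladder below \<gamma> is smaller than
        \<open>cf \<gamma>\<close>, hence bounded; above the bound the next ladder point is \<gamma>
        itself.\<close>
      then have "\<exists>c\<in>{..<\<gamma>}. \<forall>x\<in>e \<xi> \<inter> {..<\<gamma>}. x < c"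
        by (intro boundingD[OF bounding_below_cf[OF \<gamma>(3)]] card_le_subset[OF _ le]) auto
      then obtain c where c: "c < \<gamma>" "\<forall>x\<in>e \<xi>. x < \<gamma> \<longrightarrow> x < c" by auto
      have "stop w z \<xi> = \<gamma>" if z: "c < z" "z < \<gamma>" for z
      proof -
        have g: "\<gamma> \<in> e \<xi>" using sub \<gamma>(2) by blast
        have "nxt z \<xi> = \<gamma>"
          using g z c(2) by (intro nxt_eq) (auto simp: less_imp_le not_less dest: leD[rotated] less_trans intro: leI)
        moreover have "z < \<xi>" using g ladder_below z(2) by (meson lessThan_iff less_trans subsetD)
        ultimately have "stop w z \<xi> = stop w z \<gamma>" using stop_rec[of w z \<xi>] le by (auto simp: not_le)
        then show ?thesis using stop_at_large_cf[OF \<gamma>(3)] by simp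
      qed
      then show ?thesis using c(1) by blast
    qed
    then show ?thesis using z0 v(1) by blast
  next
    case False
    then obtain a0 where a0: "a0 < \<delta>" "\<forall>x\<in>e \<xi>. a0 < x \<longrightarrow> \<delta> \<le> x"
      using z0 unfolding unbounded_in_def by (meson not_le)
    have "\<xi> \<noteq> \<delta>"
    proof
      assume eq: "\<xi> = \<delta>"
      obtain y where "a0 < y" "y < \<delta>" using limit_of_cf[OF cf a0(1)] by blast
      moreover obtain x where "x \<in> e \<xi>" "y \<le> x" using ladder_cofinal[of y \<xi>] \<open>y < \<delta>\<close> eq by blast
      ultimately show False using a0(2) ladder_below[of \<xi>] eq by (meson lessThan_iff less_le_trans not_le subsetD)
    qed
    then have "\<delta> < \<xi>" using less.prems by simp
    \<comment> \<open>Every \<open>z\<close> between \<open>a0\<close> and \<delta> has the same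
      next node, still at or above \<delta>, so the induction hypothesis applies to it.\<close>
    define \<xi>' where "\<xi>' = nxt \<delta> \<xi>"
    have \<xi>': "\<xi>' \<in> e \<xi>" "\<delta> \<le> \<xi>'" "\<xi>' < \<xi>" unfolding \<xi>'_def using nxt_props[OF \<open>\<delta> < \<xi>\<close>] by auto
    have nx: "nxt z \<xi> = \<xi>'" if z: "a0 < z" "z < \<delta>" for z
    proof (rule nxt_eq[OF \<xi>'(1)])
      show "z \<le> \<xi>'" using z(2) \<xi>'(2) by simp
      fix y assume y: "y \<in> e \<xi>" "z \<le> y"
      then have "\<delta> \<le> y" using a0(2) z(1) by (meson less_le_trans)
      then show "\<xi>' \<le> y" unfolding \<xi>'_def nxt_def using y(1) by (intro Least_le) simp
    qed
    obtain a v' where IH: "a < \<delta>" "v' < \<mu>" "\<And>w \<gamma>. v' \<le> w \<Longrightarrow> \<gamma> \<in> C \<Longrightarrow> a < \<gamma> \<Longrightarrow> w < cf \<gamma> \<Longrightarrow>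
        \<exists>c<\<gamma>. \<forall>z. c < z \<longrightarrow> z < \<gamma> \<longrightarrow> stop w z \<xi>' = \<gamma>"
      using less.IH[OF \<xi>'(3,2)] by meson
    have "\<exists>c<\<gamma>. \<forall>z. c < z \<longrightarrow> z < \<gamma> \<longrightarrow> stop w z \<xi> = \<gamma>"
      if \<gamma>: "max v v' \<le> w" "\<gamma> \<in> C" "max a a0 < \<gamma>" "w < cf \<gamma>" for w \<gamma>
    proof -
      obtain c where c: "c < \<gamma>" "\<forall>z. c < z \<longrightarrow> z < \<gamma> \<longrightarrow> stop w z \<xi>' = \<gamma>"
        using IH(3)[of w \<gamma>] \<gamma> by auto
      have le: "|e \<xi>| \<le>o |{..<w}|" using v(2) card_lessThan_mono[of v w] card_le_trans \<gamma>(1) by auto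
      have "stop w z \<xi> = \<gamma>" if z: "max c a0 < z" "z < \<gamma>" for z
      proof -
        have "\<gamma> < \<delta>" using C \<gamma>(2) by auto
        then have "z < \<delta>" using z(2) by simp
        then have "stop w z \<xi> = stop w z \<xi>'"
          using stop_rec[of w z \<xi>] le nx[of z] z(1) \<open>\<delta> < \<xi>\<close> by auto
        then show ?thesis using c(2) z by simp
      qed
      then show ?thesis using c(1) \<gamma>(3) by (intro exI[of _ "max c a0"]) auto
    qed
    moreover have "max a a0 < \<delta>" "max v v' < \<mu>" using IH(1,2) a0(1) v(1) by auto
    ultimately show ?thesis by blast
  qed
qed

text \<open>Three uniform bounds over \<open>B\<close>: below \<delta> since
  \<open>cf \<delta> = \<theta>\<close>, for the thresholds since
  \<open>cf \<mu> = \<theta>\<close>, and below \<gamma> since \<open>|B| \<le> |w|\<close> with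
  \<open>w < cf \<gamma>\<close>. The third is why the threshold is raised to at least
  \<theta>.\<close>

lemma walks_through:
  assumes cf: "cf \<delta> = \<theta>" and C: "C \<subseteq> {..<\<delta>}"
    and swallow: "\<And>\<xi>. \<delta> \<le> \<xi> \<Longrightarrow> unbounded_in (e \<xi>) \<delta> \<Longrightarrow> C \<subseteq> e \<xi>"
    and B: "|B| <o |{..<\<theta>}|" "B \<subseteq> {\<delta>..}"
  shows "\<exists>a<\<delta>. \<exists>v<\<mu>. \<forall>w. v \<le> w \<longrightarrow> (\<forall>\<gamma>\<in>C. a < \<gamma> \<longrightarrow> w < cf \<gamma> \<longrightarrow>
    (\<exists>c<\<gamma>. \<forall>z. c < z \<longrightarrow> z < \<gamma> \<longrightarrow> (\<forall>\<xi>\<in>B. stop w z \<xi> = \<gamma>)))"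
proof -
  define F where "F a v \<xi> \<longleftrightarrow> (\<forall>w. v \<le> w \<longrightarrow> (\<forall>\<gamma>\<in>C. a < \<gamma> \<longrightarrow> w < cf \<gamma> \<longrightarrow>
      (\<exists>c<\<gamma>. \<forall>z. c < z \<longrightarrow> z < \<gamma> \<longrightarrow> stop w z \<xi> = \<gamma>)))" for a v \<xi>
  have "\<exists>a<\<delta>. \<exists>v<\<mu>. F a v \<xi>" if "\<xi> \<in> B" for \<xi>
    unfolding F_def using B(2) that by (intro walk_through[OF cf C swallow]) auto
  then obtain a v where av: "\<And>\<xi>. \<xi> \<in> B \<Longrightarrow> a \<xi> < \<delta> \<and> v \<xi> < \<mu> \<and> F (a \<xi>) (v \<xi>) \<xi>" by metis
  obtain k where k: "k < \<theta>" "|B| \<le>o |{..<k}|" using card_less_segment[OF B(1)] by blast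
  have "\<exists>a'\<in>{..<\<delta>}. \<forall>\<xi>\<in>B. a \<xi> < a'"
    using av k(1) cf by (intro bounding_image[OF bounding_below_cf k(2)]) auto
  then obtain a' where a': "a' < \<delta>" "\<forall>\<xi>\<in>B. a \<xi> < a'" by auto
  have "\<exists>v'\<in>{..<\<mu>}. \<forall>\<xi>\<in>B. v \<xi> < v'"
    using av by (intro bounding_image[OF bounding_mu[OF k(1)] k(2)]) auto
  then obtain v' where v': "v' < \<mu>" "\<forall>\<xi>\<in>B. v \<xi> < v'" by auto
  have "\<exists>c<\<gamma>. \<forall>z. c < z \<longrightarrow> z < \<gamma> \<longrightarrow> (\<forall>\<xi>\<in>B. stop w z \<xi> = \<gamma>)"
    if w: "max v' \<theta> \<le> w" "\<gamma> \<in> C" "a' < \<gamma>" "w < cf \<gamma>" for w \<gamma>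
  proof -
    have "\<exists>c<\<gamma>. \<forall>z. c < z \<longrightarrow> z < \<gamma> \<longrightarrow> stop w z \<xi> = \<gamma>" if \<xi>: "\<xi> \<in> B" for \<xi>
    proof -
      have "v \<xi> \<le> w" "a \<xi> < \<gamma>" using v'(2) a'(2) w(1,3) \<xi> by (auto dest: bspec)
      with av[OF \<xi>] w(2,4) show ?thesis unfolding F_def by simp
    qed
    then obtain c where c: "\<And>\<xi>. \<xi> \<in> B \<Longrightarrow> c \<xi> < \<gamma> \<and> (\<forall>z. c \<xi> < z \<longrightarrow> z < \<gamma> \<longrightarrow> stop w z \<xi> = \<gamma>)" by metis
    have "|B| \<le>o |{..<w}|" using card_le_trans[OF k(2) card_lessThan_mono] k(1) w(1) by auto
    then have "\<exists>c'\<in>{..<\<gamma>}. \<forall>\<xi>\<in>B. c \<xi> < c'"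
      using c by (intro bounding_image[OF bounding_below_cf[OF w(4)]]) auto
    then obtain c' where "c' < \<gamma>" "\<forall>\<xi>\<in>B. c \<xi> < c'" by auto
    then show ?thesis using c by (meson less_trans)
  qed
  moreover have "max v' \<theta> < \<mu>" using v'(1) cf_mu by simp
  ultimately show ?thesis using a'(1) by blast
qed

end

section \<open>The coloring with \<open>\<mu>\<^sup>+\<close> colors\<close>

text \<open>Without such a \<gamma> the single generator for \<alpha> and \<beta> would contain
  \<open>A\<close>.\<close>

lemma generated_ideal_positive:
  assumes "A \<notin> ideal_generated X
      {{\<gamma> \<in> X. \<gamma> \<in> acc_pts X \<or> cf \<gamma> < \<alpha> \<or> \<gamma> < \<beta>} | \<alpha> \<beta>. \<alpha> < \<mu> \<and> \<beta> < \<delta>}"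
    and "A \<subseteq> X" "\<alpha> < \<mu>" "\<beta> < \<delta>"
  shows "\<exists>\<gamma>\<in>A. \<alpha> \<le> cf \<gamma> \<and> \<beta> \<le> \<gamma>"
proof (rule ccontr)
  assume n: "\<not> ?thesis"
  let ?Z = "{\<gamma> \<in> X. \<gamma> \<in> acc_pts X \<or> cf \<gamma> < \<alpha> \<or> \<gamma> < \<beta>}"
  have sub: "A \<subseteq> \<Union>{?Z}" using n assms(2) by (auto simp: not_le)
  have "\<exists>F. finite F \<and> F \<subseteq> {{\<gamma> \<in> X. \<gamma> \<in> acc_pts X \<or> cf \<gamma> < \<alpha> \<or> \<gamma> < \<beta>} | \<alpha> \<beta>. \<alpha> < \<mu> \<and> \<beta> < \<delta>} \<and> A \<subseteq> \<Union>F"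
    using assms(3,4) by (intro exI[of _ "{?Z}"] conjI sub) auto
  then show False using assms(1,2) unfolding ideal_generated_def by blast
qed

theorem theorem5p1:
  fixes \<mu> :: "'a::wellorder"
    and S :: "'a set"
    and C :: "'a \<Rightarrow> 'a set"
    and I :: "'a \<Rightarrow> 'a set set"
  assumes "singular_cardinal \<mu>"
    and "is_successor_of TYPE('a) \<mu>"
    and "stationary S"
    and "S \<subseteq> {\<delta>. cf \<delta> = cf \<mu>}"
    and "good_pair \<mu> S C I"
    and "\<not> weakly_saturated UNIV (id_p S C I) {..<\<mu>}"
  shows "Pr1 (UNIV :: 'a set) UNIV UNIV {..<cf \<mu>}"
proof -
  interpret singular_successor \<mu> by (unfold_locales) (fact assms(1,2))+
  have cfS: "cf \<delta> = \<theta>" if "\<delta> \<in> S" for \<delta> using assms(4) that by blast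
  have C_club: "\<forall>\<delta>\<in>S. club_in {..<\<delta>} (C \<delta>)"
    and C_small: "\<exists>\<kappa><\<mu>. \<forall>\<delta>\<in>S. |C \<delta>| \<le>o |{..<\<kappa>}|"
    and I_def: "\<forall>\<delta>\<in>S. I \<delta> = ideal_generated (C \<delta>)
        {{\<gamma> \<in> C \<delta>. \<gamma> \<in> acc_pts (C \<delta>) \<or> cf \<gamma> < \<alpha> \<or> \<gamma> < \<beta>} | \<alpha> \<beta>. \<alpha> < \<mu> \<and> \<beta> < \<delta>}"
    and guess: "\<forall>E. club_in UNIV E \<longrightarrow> stationary {\<delta> \<in> S. E \<inter> C \<delta> \<notin> I \<delta>}"
    using assms(5) by (simp_all add: good_pair_def)
  have C_below: "C \<delta> \<subseteq> {..<\<delta>}" if "\<delta> \<in> S" for \<delta> using C_club that by (simp add: club_in_def)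
  define positive where "positive \<delta> A \<longleftrightarrow> (\<forall>\<alpha><\<mu>. \<forall>\<beta><\<delta>. \<exists>\<gamma>\<in>A \<inter> C \<delta>. \<alpha> \<le> cf \<gamma> \<and> \<beta> \<le> \<gamma>)" for \<delta> A
  have positive: "positive \<delta> A" if "\<delta> \<in> S" "A \<inter> C \<delta> \<notin> I \<delta>" for \<delta> A
    unfolding positive_def
  proof (intro allI impI)
    fix \<alpha> \<beta> assume ab: "\<alpha> < \<mu>" "\<beta> < \<delta>"
    have "A \<inter> C \<delta> \<notin> ideal_generated (C \<delta>)
        {{\<gamma> \<in> C \<delta>. \<gamma> \<in> acc_pts (C \<delta>) \<or> cf \<gamma> < \<alpha> \<or> \<gamma> < \<beta>} | \<alpha> \<beta>. \<alpha> < \<mu> \<and> \<beta> < \<delta>}"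
      using that I_def by simp
    then show "\<exists>\<gamma>\<in>A \<inter> C \<delta>. \<alpha> \<le> cf \<gamma> \<and> \<beta> \<le> \<gamma>" using ab by (rule generated_ideal_positive[OF _ Int_lower2])
  qed
  have positive_mono: "positive \<delta> B" if "positive \<delta> A" "A \<subseteq> B" for \<delta> A B
    using that unfolding positive_def by (meson Int_mono order_refl subsetD)
  obtain \<pi> where \<pi>: "\<And>x. \<pi> x < \<mu>" "\<And>i. i < \<mu> \<Longrightarrow> {x. \<pi> x = i} \<notin> id_p S C I"
    using assms(6) unfolding weakly_saturated_def by auto
  have \<pi>_positive: "\<exists>\<delta>\<in>S \<inter> E. positive \<delta> (E \<inter> {x. \<pi> x = i})" if "i < \<mu>" "club_in UNIV E" for i E
  proof -
    have "\<exists>\<delta>\<in>S \<inter> E. E \<inter> {x. \<pi> x = i} \<inter> C \<delta> \<notin> I \<delta>"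
      using \<pi>(2)[OF that(1)] that(2) unfolding id_p_def by blast
    then show ?thesis using positive by (metis IntD1)
  qed
  obtain \<kappa> where \<kappa>: "\<kappa> < \<mu>" "\<forall>\<delta>\<in>S. |C \<delta>| \<le>o |{..<\<kappa>}|" using C_small by blast
  have "\<exists>e\<subseteq>{..<\<xi>}. (\<forall>x<\<xi>. \<exists>y\<in>e. x \<le> y) \<and> (\<exists>v<\<mu>. |e| \<le>o |{..<v}| )
    \<and> (\<forall>\<delta>\<in>S. \<delta> \<le> \<xi> \<longrightarrow> unbounded_in e \<delta> \<longrightarrow> C \<delta> \<subseteq> e)" for \<xi>
    using cfS C_below \<kappa> by (intro swallowing_ladder[of S C \<kappa>]) simp_all
  then obtain e where e: "\<And>\<xi>. e \<xi> \<subseteq> {..<\<xi>} \<and> (\<forall>x<\<xi>. \<exists>y\<in>e \<xi>. x \<le> y) \<and> (\<exists>v<\<mu>. |e \<xi>| \<le>o |{..<v}| )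
    \<and> (\<forall>\<delta>\<in>S. \<delta> \<le> \<xi> \<longrightarrow> unbounded_in (e \<xi>) \<delta> \<longrightarrow> C \<delta> \<subseteq> e \<xi>)"
    by metis
  interpret ladder_system \<mu> e by unfold_locales (use e in simp_all)
  have swallow: "C \<delta> \<subseteq> e \<xi>" if "\<delta> \<in> S" "\<delta> \<le> \<xi>" "unbounded_in (e \<xi>) \<delta>" for \<delta> \<xi>
    using e that by blast
  obtain \<Gamma> :: "'a \<Rightarrow> 'a \<Rightarrow> 'a \<times> 'a" where G0:
    "\<forall>t. (\<forall>\<alpha>. |t \<alpha>| <o |{..<\<theta>}| ) \<longrightarrow> (\<forall>\<alpha> \<beta>. \<alpha> \<noteq> \<beta> \<longrightarrow> t \<alpha> \<inter> t \<beta> = {}) \<longrightarrow>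
      (\<forall>a. \<exists>\<beta>0. \<forall>\<beta>. t \<beta> \<subseteq> {\<beta>0..} \<longrightarrow> (\<forall>c\<in>{..<\<theta>} \<times> {..<\<theta>}.
        \<exists>\<alpha>. a < \<alpha> \<and> \<alpha> < \<beta>0 \<and> t \<alpha> \<subseteq> {a<..} \<and> (\<forall>\<zeta>\<in>t \<alpha>. \<forall>\<xi>\<in>t \<beta>. \<Gamma> \<zeta> \<xi> = c)))"
    using rectangular_coloring by (rule exE)
  note \<Gamma> = G0[THEN spec, THEN mp, THEN mp, THEN spec]
  \<comment> \<open>The first index recovers \<gamma>1 from the walk, the second \<gamma>2; then
    \<open>\<pi> \<gamma>2\<close> is decoded by the enumeration of \<gamma>1.\<close>
  define f where "f u = (let \<zeta> = Min u; \<xi> = Max u; \<gamma> = stop (nu (fst (\<Gamma> \<zeta> \<xi>))) \<zeta> \<xi>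
    in inv_into {..<\<gamma>} (enum_below \<gamma>) (\<pi> (stop (nu (snd (\<Gamma> \<zeta> \<xi>))) \<zeta> \<xi>)))" for u :: "'a set"
  have main: "\<exists>\<alpha> \<beta>. \<alpha> < \<beta> \<and> (\<forall>\<zeta>\<in>t \<alpha>. \<forall>\<xi>\<in>t \<beta>. f {\<zeta>, \<xi>} = \<epsilon>)"
    if t: "\<forall>\<alpha>. |t \<alpha>| <o |{..<\<theta>}|" "\<forall>\<alpha> \<beta>. \<alpha> \<noteq> \<beta> \<longrightarrow> t \<alpha> \<inter> t \<beta> = {}" for t :: "'a \<Rightarrow> 'a set" and \<epsilon> :: 'a
  proof -
    define Q where "Q a \<beta>0 \<longleftrightarrow> (\<forall>\<beta>. t \<beta> \<subseteq> {\<beta>0..} \<longrightarrow> (\<forall>c\<in>{..<\<theta>} \<times> {..<\<theta>}.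
      \<exists>\<alpha>. a < \<alpha> \<and> \<alpha> < \<beta>0 \<and> t \<alpha> \<subseteq> {a<..} \<and> (\<forall>\<zeta>\<in>t \<alpha>. \<forall>\<xi>\<in>t \<beta>. \<Gamma> \<zeta> \<xi> = c)))" for a \<beta>0
    have "\<exists>\<beta>0. Q a \<beta>0" for a unfolding Q_def by (rule \<Gamma>[OF t])
    then obtain b0 where "\<And>a. Q a (b0 a)" by metis
    then have b0: "\<exists>\<alpha>. a < \<alpha> \<and> \<alpha> < b0 a \<and> t \<alpha> \<subseteq> {a<..} \<and> (\<forall>\<zeta>\<in>t \<alpha>. \<forall>\<xi>\<in>t \<beta>. \<Gamma> \<zeta> \<xi> = c)"
      if "t \<beta> \<subseteq> {b0 a..}" "c \<in> {..<\<theta>} \<times> {..<\<theta>}" for a \<beta> c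
      using that unfolding Q_def by auto
    \<comment> \<open>Closure under \<open>b0\<close> puts the index \<alpha> of the lower set below
      \<gamma>2, and closure under \<open>ssup (t x)\<close> then puts the whole of
      \<open>t \<alpha>\<close> below \<gamma>2.\<close>
    define F1 where "F1 x = max (b0 x) (ssup (t x))" for x
    define E1 where "E1 = closure_points F1 UNIV"
    have E1_sub: "closure_points F UNIV \<subseteq> E1" if "\<And>x. F1 x \<le> F x" for F
      unfolding E1_def closure_points_def using le_less_trans[OF that] by blast
    have "\<exists>\<delta>. x < \<delta> \<and> \<delta> \<in> S \<and> positive \<delta> (E1 \<inter> {z. \<pi> z = y})" if y: "y < \<mu>" for x y
    proof -
      define E where "E = closure_points (\<lambda>z. max (F1 z) x) UNIV"
      have "club_in UNIV E" unfolding E_def by (intro closure_points_club[OF succ_like_UNIV]) simp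
      then obtain \<delta> where \<delta>: "\<delta> \<in> S" "\<delta> \<in> E" "positive \<delta> (E \<inter> {z. \<pi> z = y})"
        using \<pi>_positive[OF y] by blast
      have "E \<subseteq> E1" unfolding E_def by (rule E1_sub) simp
      then have "positive \<delta> (E1 \<inter> {z. \<pi> z = y})" by (intro positive_mono[OF \<delta>(3)]) auto
      moreover have "x < \<delta>" using \<delta>(2) unfolding E_def closure_points_def by auto
      ultimately show ?thesis using \<delta>(1) by blast
    qed
    then have "\<forall>y x. \<exists>\<delta>. y < \<mu> \<longrightarrow> x < \<delta> \<and> \<delta> \<in> S \<and> positive \<delta> (E1 \<inter> {z. \<pi> z = y})" by blast
    then obtain d where d: "\<And>x y. y < \<mu> \<Longrightarrow> x < d y x \<and> d y x \<in> S \<and> positive (d y x) (E1 \<inter> {z. \<pi> z = y})"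
      by metis
    \<comment> \<open>The relevant \<open>y\<close> is determined by \<gamma>1, yet
      \<open>d y x\<close> has to be below \<gamma>1; bounding all \<mu> cases beforehand breaks the
      circle.\<close>
    have "\<exists>c. \<forall>y\<in>{..<\<mu>}. d y x < c" for x
      using bounding_image[OF bounding_UNIV card_le_refl, of "\<lambda>y. d y x"] by auto
    then obtain dd where dd: "\<And>x y. y < \<mu> \<Longrightarrow> d y x < dd x" by (metis lessThan_iff)
    define E2 where "E2 = closure_points (\<lambda>x. max \<epsilon> (dd x)) UNIV"
    have "club_in UNIV E2" unfolding E2_def by (intro closure_points_club[OF succ_like_UNIV]) simp
    then have "stationary {\<delta> \<in> S. E2 \<inter> C \<delta> \<notin> I \<delta>}" using guess by blast
    moreover have "club_in UNIV (UNIV :: 'a set)" by (auto simp: club_in_def)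
    ultimately have "{\<delta> \<in> S. E2 \<inter> C \<delta> \<notin> I \<delta>} \<noteq> {}" unfolding stationary_def by blast
    then obtain \<delta> where \<delta>: "\<delta> \<in> S" "positive \<delta> E2" using positive by blast
    obtain \<beta> where \<beta>: "\<delta> < \<beta>" "t \<beta> \<subseteq> {\<delta><..}" using disjoint_family_far[of t \<delta>] t(2) by auto
    have "\<exists>a<\<delta>. \<exists>v<\<mu>. \<forall>w. v \<le> w \<longrightarrow> (\<forall>\<gamma>\<in>C \<delta>. a < \<gamma> \<longrightarrow> w < cf \<gamma> \<longrightarrow>
        (\<exists>c<\<gamma>. \<forall>z. c < z \<longrightarrow> z < \<gamma> \<longrightarrow> (\<forall>\<xi>\<in>t \<beta>. stop w z \<xi> = \<gamma>)))"
      using t(1) \<beta>(2) swallow[OF \<delta>(1)] by (intro walks_through[OF cfS C_below] \<delta>(1)) (auto simp: less_imp_le)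
    then obtain a1 v1 where 1: "a1 < \<delta>" "v1 < \<mu>" "\<And>w \<gamma>. v1 \<le> w \<Longrightarrow> \<gamma> \<in> C \<delta> \<Longrightarrow> a1 < \<gamma> \<Longrightarrow> w < cf \<gamma> \<Longrightarrow>
        \<exists>c<\<gamma>. \<forall>z. c < z \<longrightarrow> z < \<gamma> \<longrightarrow> (\<forall>\<xi>\<in>t \<beta>. stop w z \<xi> = \<gamma>)" by meson
    obtain i1 where i1: "i1 < \<theta>" "v1 < nu i1" using nu_cofinal[OF 1(2)] by blast
    \<comment> \<open>\<open>positive\<close> yields weak inequalities only; going one step further,
      here and for \<open>\<beta>1\<close>, makes them strict.\<close>
    obtain \<alpha>1 where \<alpha>1: "nu i1 < \<alpha>1" "\<alpha>1 < \<mu>" using mu_limit[OF nu_less[OF i1(1)]] by blast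
    obtain \<beta>1 where \<beta>1: "a1 < \<beta>1" "\<beta>1 < \<delta>" using limit_of_cf[OF cfS[OF \<delta>(1)] 1(1)] by blast
    obtain \<gamma>1 where "\<gamma>1 \<in> E2 \<inter> C \<delta>" "\<alpha>1 \<le> cf \<gamma>1" "\<beta>1 \<le> \<gamma>1"
      using \<delta>(2) \<alpha>1(2) \<beta>1(2) unfolding positive_def by blast
    then have \<gamma>1: "\<gamma>1 \<in> E2" "\<gamma>1 \<in> C \<delta>" "nu i1 < cf \<gamma>1" "a1 < \<gamma>1" using \<alpha>1(1) \<beta>1(1) by auto
    obtain c1 where c1: "c1 < \<gamma>1" "\<forall>z. c1 < z \<longrightarrow> z < \<gamma>1 \<longrightarrow> (\<forall>\<xi>\<in>t \<beta>. stop (nu i1) z \<xi> = \<gamma>1)"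
      using 1(3)[OF less_imp_le[OF i1(2)] \<gamma>1(2,4,3)] by blast
    have "\<exists>y<\<gamma>1. c1 < y \<and> max \<epsilon> (dd c1) < y" using \<gamma>1(1) c1(1) unfolding E2_def closure_points_def by blast
    then have \<epsilon>: "\<epsilon> < \<gamma>1" and dd1: "dd c1 < \<gamma>1" by (auto dest: less_trans)
    define y where "y = enum_below \<gamma>1 \<epsilon>"
    have y: "y < \<mu>" unfolding y_def using enum_below[of \<gamma>1] \<epsilon> by auto
    define \<delta>2 where "\<delta>2 = d y c1"
    have \<delta>2: "c1 < \<delta>2" "\<delta>2 < \<gamma>1" "\<delta>2 \<in> S" "positive \<delta>2 (E1 \<inter> {z. \<pi> z = y})"
      unfolding \<delta>2_def using d[OF y, of c1] dd[OF y, of c1] dd1 by auto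
    have "|{\<gamma>1}| <o |{..<\<theta>}|" 
      using infinite_cf card_of_ordLeq_finite[of "{..<\<theta>}" "{\<gamma>1}"]
        not_ordLeq_iff_ordLess[OF card_of_Well_order card_of_Well_order] by blast
    then have "\<exists>a<\<delta>2. \<exists>v<\<mu>. \<forall>w. v \<le> w \<longrightarrow> (\<forall>\<gamma>\<in>C \<delta>2. a < \<gamma> \<longrightarrow> w < cf \<gamma> \<longrightarrow>
        (\<exists>c<\<gamma>. \<forall>z. c < z \<longrightarrow> z < \<gamma> \<longrightarrow> (\<forall>\<xi>\<in>{\<gamma>1}. stop w z \<xi> = \<gamma>)))"
      using \<delta>2(2) swallow[OF \<delta>2(3)] by (intro walks_through[OF cfS C_below] \<delta>2(3)) (auto simp: less_imp_le)
    then obtain a2 v2 where 2: "a2 < \<delta>2" "v2 < \<mu>" "\<And>w \<gamma>. v2 \<le> w \<Longrightarrow> \<gamma> \<in> C \<delta>2 \<Longrightarrow> a2 < \<gamma> \<Longrightarrow> w < cf \<gamma> \<Longrightarrow>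
        \<exists>c<\<gamma>. \<forall>z. c < z \<longrightarrow> z < \<gamma> \<longrightarrow> stop w z \<gamma>1 = \<gamma>" by (metis singletonI)
    \<comment> \<open>\<open>nu i2\<close> must also exceed the first threshold, so that
      \<open>stop_stop\<close> applies.\<close>
    have "max v2 (nu i1) < \<mu>" using 2(2) nu_less[OF i1(1)] by simp
    then obtain i2 where i2: "i2 < \<theta>" "max v2 (nu i1) < nu i2" using nu_cofinal by blast
    obtain \<alpha>2 where \<alpha>2: "nu i2 < \<alpha>2" "\<alpha>2 < \<mu>" using mu_limit[OF nu_less[OF i2(1)]] by blast
    have "max a2 c1 < \<delta>2" using 2(1) \<delta>2(1) by simp
    then obtain \<beta>2 where \<beta>2: "max a2 c1 < \<beta>2" "\<beta>2 < \<delta>2" using limit_of_cf[OF cfS[OF \<delta>2(3)]] by blast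
    obtain \<gamma>2 where "\<gamma>2 \<in> (E1 \<inter> {z. \<pi> z = y}) \<inter> C \<delta>2" "\<alpha>2 \<le> cf \<gamma>2" "\<beta>2 \<le> \<gamma>2"
      using \<delta>2(4) \<alpha>2(2) \<beta>2(2) unfolding positive_def by blast
    then have \<gamma>2: "\<gamma>2 \<in> E1" "\<pi> \<gamma>2 = y" "\<gamma>2 \<in> C \<delta>2" "nu i2 < cf \<gamma>2" "a2 < \<gamma>2" "c1 < \<gamma>2"
      using \<alpha>2(1) \<beta>2(1) by auto
    obtain c2 where c2: "c2 < \<gamma>2" "\<forall>z. c2 < z \<longrightarrow> z < \<gamma>2 \<longrightarrow> stop (nu i2) z \<gamma>1 = \<gamma>2"
      using 2(3)[OF _ \<gamma>2(3,5,4)] i2(2) by (auto simp: less_imp_le)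
    have lt: "\<gamma>2 < \<delta>2" "\<gamma>1 < \<delta>" using C_below \<gamma>2(3) \<gamma>1(2) \<delta>(1) \<delta>2(3) by auto
    have closed: "b0 x < \<gamma>2 \<and> ssup (t x) < \<gamma>2" if "x < \<gamma>2" for x
    proof -
      have "\<exists>z<\<gamma>2. x < z \<and> F1 x < z" using \<gamma>2(1) that unfolding E1_def closure_points_def by blast
      then show ?thesis by (auto simp: F1_def dest: less_trans)
    qed
    \<comment> \<open>Every \<zeta> above \<open>a\<close> and below \<gamma>2 lies in both
      intervals on which the walks are controlled.\<close>
    define a where "a = max c1 c2"
    have a: "a < \<gamma>2" using \<gamma>2(6) c2(1) by (simp add: a_def)
    have "b0 a < \<delta>" using closed[OF a] lt \<delta>2(2) by (meson less_trans)
    then have "t \<beta> \<subseteq> {b0 a..}" using \<beta>(2) by (auto intro: less_imp_le less_trans)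
    then obtain \<alpha> where \<alpha>: "a < \<alpha>" "\<alpha> < b0 a" "t \<alpha> \<subseteq> {a<..}" "\<forall>\<zeta>\<in>t \<alpha>. \<forall>\<xi>\<in>t \<beta>. \<Gamma> \<zeta> \<xi> = (i1, i2)"
      using b0[of \<beta> a "(i1, i2)"] i1(1) i2(1) by auto
    have "\<alpha> < \<gamma>2" using \<alpha>(2) closed[OF a] by (meson less_trans)
    have "f {\<zeta>, \<xi>} = \<epsilon>" if z: "\<zeta> \<in> t \<alpha>" "\<xi> \<in> t \<beta>" for \<zeta> \<xi>
    proof -
      have "|t \<alpha>| \<le>o |{..<\<mu>}|"
        using t(1) cf_mu card_lessThan_mono[of \<theta> \<mu>] ordLess_imp_ordLeq card_le_trans less_imp_le by metis
      then have "\<zeta> < ssup (t \<alpha>)" using z(1) by (rule ssup_upper_UNIV)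
      then have \<zeta>2: "\<zeta> < \<gamma>2" using closed[OF \<open>\<alpha> < \<gamma>2\<close>] by (meson less_trans)
      then have \<zeta>1: "\<zeta> < \<gamma>1" using lt(1) \<delta>2(2) by (meson less_trans)
      have "\<delta> < \<xi>" using \<beta>(2) z(2) by auto
      then have "\<zeta> < \<xi>" using \<zeta>1 lt(2) by (meson less_trans)
      then have mm: "Min {\<zeta>, \<xi>} = \<zeta>" "Max {\<zeta>, \<xi>} = \<xi>" by (auto simp: min_def max_def)
      have az: "c1 < \<zeta>" "c2 < \<zeta>" using subsetD[OF \<alpha>(3) z(1)] by (auto simp: a_def)
      have s1: "stop (nu i1) \<zeta> \<xi> = \<gamma>1" using c1(2) az(1) \<zeta>1 z(2) by blast
      have "stop (nu i2) \<zeta> \<xi> = stop (nu i2) \<zeta> \<gamma>1"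
        using stop_stop[of "nu i1" "nu i2" \<zeta> \<xi>] i2(2) unfolding s1 by (simp add: less_imp_le)
      then have s2: "stop (nu i2) \<zeta> \<xi> = \<gamma>2" using c2(2) az(2) \<zeta>2 by simp
      have "f {\<zeta>, \<xi>} = inv_into {..<\<gamma>1} (enum_below \<gamma>1) y"
        unfolding f_def mm using \<alpha>(4) z s1 s2 \<gamma>2(2) by (simp add: Let_def)
      also have "\<dots> = \<epsilon>"
        unfolding y_def using enum_below[of \<gamma>1] \<epsilon> by (intro inv_into_f_f) auto
      finally show ?thesis .
    qed
    moreover have "\<alpha> < \<beta>" using \<open>\<alpha> < \<gamma>2\<close> lt \<delta>2(2) \<beta>(1) by (meson less_trans)
    ultimately show ?thesis by blast
  qed
  show ?thesis
    unfolding Pr1_def using main by (intro exI[of _ f]) auto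
qed

end
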